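(* For $n\ge 0$ let $B_n$ be the number of weakly increasing binary trees of size $n$. Then there is a constant $\eta$, with numerical value $\eta\approx 0.647852\dots$, such that $$B_n \sim \eta\, n^{-\ln 2}\left(\frac{1}{\ln 2}\right)^n (n-1)!\qquad\text{as } n\to\infty .$$
   Context: A weakly increasing binary tree is a (non-empty) rooted plane binary tree, not necessarily complete, i.e. each node has arity $0$, $1$ (with two possibilities: either only a left child or only a right child) or $2$, whose nodes carry positive integer labels such that: (i) if a node has label $k$, then all integers from $1$ to $k-1$ also appear as labels in the tree, so that the set of labels is $\{1,2,\dots,m\}$ where $m$ is the maximal label; (ii) along each branch, starting from the root, the sequence of labels is strictly increasing. The same label may appear several times in the tree (on different branches). The completed tree is obtained by attaching unlabeled leaves to every labeled node of arity smaller than $2$ (in the missing child positions) so that every labeled node has arity exactly $2$. The size of a weakly increasing binary tree is the number of (unlabeled) leaves of its completed tree. Thus $B_0=B_1=0$, $B_2=1$, $B_3=2$, $B_4=7$, $B_5=34$.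
   Formalization: The printed value 0.647852… is wrong from the fifth decimal on (the constant is about 0.647808; the printed figure is the ratio at n = 5000), so the formal statement claims only that η differs from 0.647852 by less than 0.00005. *)

theory Defs
  imports Complex_Main "HOL-Library.Tree" "HOL-Library.Landau_Symbols"
begin

(* A value of type nat tree is read as the completed tree: a constructor Node is a labeled
   node, and a constructor Leaf is one of the unlabeled leaves that fill the missing child
   positions.  Hence size1, which counts the constructors Leaf, is the size used here, and
   Leaf alone stands for the empty tree. *)

(* Label sequences from the root down to each unlabeled leaf. *)
fun branches :: "'a tree \<Rightarrow> 'a list set" where
  "branches Leaf = {[]}"
| "branches (Node l a r) = (#) a ` (branches l \<union> branches r)"

definition weakly_increasing_binary_tree :: "nat tree \<Rightarrow> bool" where
  "weakly_increasing_binary_tree t \<longleftrightarrow>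
     t \<noteq> Leaf \<and>
     (\<forall>k \<in> set_tree t. 0 < k) \<and>
     (\<forall>k \<in> set_tree t. {1..k - 1} \<subseteq> set_tree t) \<and>
     (\<forall>b \<in> branches t. sorted_wrt (<) b)"

definition B :: "nat \<Rightarrow> nat" where
  "B n = card {t. weakly_increasing_binary_tree t \<and> size1 t = n}"

lemma finite_trees_with_labels:
  assumes "finite A"
  shows "finite {t. set_tree t \<subseteq> A \<and> size t \<le> n}"
proof (induction n)
  case 0
  have "{t. set_tree t \<subseteq> A \<and> size t \<le> 0} \<subseteq> {Leaf}"
    by auto
  then show ?case
    by (rule finite_subset) simp
next
  case (Suc n)
  let ?T = "{t. set_tree t \<subseteq> A \<and> size t \<le> n}"
  have "t \<in> insert Leaf ((\<lambda>(l, a, r). Node l a r) ` (?T \<times> A \<times> ?T))"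
    if "set_tree t \<subseteq> A" "size t \<le> Suc n" for t
    using that by (cases t) (auto simp: image_iff)
  then have "{t. set_tree t \<subseteq> A \<and> size t \<le> Suc n}
      \<subseteq> insert Leaf ((\<lambda>(l, a, r). Node l a r) ` (?T \<times> A \<times> ?T))"
    by blast
  then show ?case
    by (rule finite_subset) (use Suc assms in simp)
qed

lemma card_set_tree_le: "card (set_tree t) \<le> size t"
proof (induction t)
  case (Node l a r)
  have "card (set_tree (Node l a r)) \<le> Suc (card (set_tree l \<union> set_tree r))"
    by (simp add: card_insert_if)
  also have "\<dots> \<le> Suc (card (set_tree l) + card (set_tree r))"
    by (simp add: card_Un_le)
  finally show ?case
    using Node.IH by simp
qed simp

(* So that card in the definition of B never takes its default value 0 on infinite sets. *)
lemma finite_weakly_increasing_binary_trees: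
  "finite {t. weakly_increasing_binary_tree t \<and> size1 t = n}"
proof (rule finite_subset)
  show "finite {t. set_tree t \<subseteq> {..n} \<and> size t \<le> n}"
    by (rule finite_trees_with_labels) simp
  show "{t. weakly_increasing_binary_tree t \<and> size1 t = n}
      \<subseteq> {t. set_tree t \<subseteq> {..n} \<and> size t \<le> n}"
  proof (clarify, intro conjI subsetI)
    fix t k
    assume t: "weakly_increasing_binary_tree t"
    show "size t \<le> size1 t"
      by (simp add: size1_size)
    assume k: "k \<in> set_tree t"
    then have "insert k {1..k - 1} \<subseteq> set_tree t"
      using t by (simp add: weakly_increasing_binary_tree_def)
    moreover have "{1..k} \<subseteq> insert k {1..k - 1}"
      by auto
    ultimately have "{1..k} \<subseteq> set_tree t"
      by (rule order_trans[rotated])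
    then have "card {1..k} \<le> card (set_tree t)"
      by (intro card_mono) auto
    then show "k \<in> {..size1 t}"
      using card_set_tree_le[of t] by (simp add: size1_size)
  qed
qed

end

theory Submission
  imports Defs "HOL-Analysis.Analysis" "HOL-Real_Asymp.Real_Asymp"
begin

text \<open>
  Deleting all nodes with the largest label of a tree of size \<open>n\<close> leaves a tree of some size
  \<open>k < n\<close>; conversely the \<open>n - k\<close> deleted nodes may have replaced any \<open>n - k\<close> of its \<open>k\<close> leaves.
  Let \<open>b n\<close> be the number of trees of size \<open>n\<close>, with the empty
  tree as the only one of size 1.  Then
  \<open>b n = (\<Sum>k<n. (k choose (n - k)) * b k)\<close> for \<open>n \<ge> 2\<close> (\<open>tree_count_rec\<close>).  The right-hand side is the
  positive linear operator \<open>growth_op\<close>, so \<open>b\<close> is compared with functions \<open>f\<close> for which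
  \<open>growth_op f\<close> lies on one side of \<open>f\<close>.

  Such functions come from integrals \<open>f n = (\<integral> E(t) * t ^ (n - 1) dt)\<close> over the positive reals.
  The polynomials \<open>(\<Sum>k\<le>n. (k choose (n - k)) * t ^ k)\<close> satisfy a linear recurrence of order two, and for
  \<open>t = \<tau> x = x\<^sup>2 / (1 + x)\<close> its dominant characteristic root is \<open>x\<close>.  By Binet's formula and
  the change of variables \<open>t = \<tau> x\<close>, \<open>f n + growth_op f n\<close> equals
  \<open>(\<integral> E(\<tau> x) * x ^ (n - 1) dx)\<close> up to a bounded error, which comes from the other root
  (\<open>growth_op_moment_integral\<close>).  Hence \<open>E(\<tau> x) \<le> 2 * E(x)\<close> for all \<open>x > 0\<close> gives
  \<open>growth_op f n \<le> f n\<close> up to a constant, and likewise with the inequality reversed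
  (\<open>growth_op_le\<close>).

  Let \<open>\<rho> = ln 2\<close>.  Since \<open>\<tau> x = x - 1 + 1 / (1 + x)\<close>, the functional equation \<open>E(\<tau> x) = 2 * E(x)\<close> has the
  formal solution \<open>exp (- \<rho> * x) * x powr (- \<rho>) * (1 - \<rho> / 2 / x + e / x\<^sup>2 - \<dots>)\<close> with
  \<open>e = \<rho> / 3 + \<rho>\<^sup>2 / 8\<close>.  Cutting it off after the first-order term makes \<open>E(\<tau> x) \<le> 2 * E(x)\<close>; cutting it
  off after the second-order term, with \<open>e\<close> replaced by the slightly larger \<open>7 / 24\<close>, makes
  \<open>E(\<tau> x) \<ge> 2 * E(x)\<close> (\<open>upper_pointwise\<close>, \<open>lower_pointwise\<close>).  The integrals of the cut-off series
  are explicit sums of Gamma values, both asymptotic to \<open>model 0 n = Gamma (n - \<rho>) / \<rho> ^ n\<close>,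
  and \<open>Gamma (n - \<rho>)\<close> is asymptotic to \<open>n powr (- \<rho>) * fact (n - 1)\<close>.

  Two things remain.  The quotient of \<open>b\<close> by the upper model converges, because its successive
  differences are summable: each value is almost a convex combination of earlier values, with weights
  at most about \<open>\<rho> ^ l / fact l\<close> at distance \<open>l\<close>, and the mean of \<open>l - 1\<close> under the limiting weights is
  \<open>2 * \<rho> - 1 < 1\<close> (\<open>ratio_convergent\<close>).  The limit is located by induction: the recurrence for size \<open>n\<close>
  involves sizes from \<open>n / 2\<close> to \<open>n - 1\<close> only, so bounds by multiples of the two models that hold
  for \<open>40 \<le> k < 80\<close> persist for all larger sizes (\<open>growth_op_comparison\<close>, \<open>window_bounds\<close>).
\<close>

section \<open>Counting trees by removing the largest label\<close>

text \<open>
  The branch condition in a form suited to structural induction.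
\<close>

fun increasing_tree :: "nat tree \<Rightarrow> bool" where
  "increasing_tree Leaf \<longleftrightarrow> True"
| "increasing_tree (Node l a r) \<longleftrightarrow>
     (\<forall>x \<in> set_tree l \<union> set_tree r. a < x) \<and> increasing_tree l \<and> increasing_tree r"

lemma branches_nonempty: "branches t \<noteq> {}"
  by (induction t) auto

lemma Union_set_branches: "(\<Union>b \<in> branches t. set b) = set_tree t"
proof (induction t)
  case (Node l a r)
  have "(\<Union>b \<in> branches (Node l a r). set b)
      = insert a ((\<Union>b \<in> branches l. set b) \<union> (\<Union>b \<in> branches r. set b))"
    using branches_nonempty[of l] by auto
  then show ?case
    using Node.IH by auto
qed simp

lemma sorted_branches_iff_increasing:
  "(\<forall>b \<in> branches t. sorted_wrt (<) b) \<longleftrightarrow> increasing_tree t"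
proof (induction t)
  case (Node l a r)
  have "(\<forall>b \<in> branches (Node l a r). sorted_wrt (<) b) \<longleftrightarrow>
      (\<forall>x \<in> (\<Union>b \<in> branches l. set b) \<union> (\<Union>b \<in> branches r. set b). a < x) \<and>
      (\<forall>b \<in> branches l. sorted_wrt (<) b) \<and> (\<forall>b \<in> branches r. sorted_wrt (<) b)"
    by auto
  then show ?case
    using Node.IH by (simp only: Union_set_branches increasing_tree.simps)
qed simp

text \<open>
  In contrast to the weakly increasing binary trees, the layered trees include \<open>Leaf\<close>, as the only one
  of size 1.  It is the tree from which all others grow, one label at a time.
\<close>

definition layered_trees :: "nat \<Rightarrow> nat tree set" where
  "layered_trees n = {t. increasing_tree t \<and> (\<exists>m. set_tree t = {1..m}) \<and> size1 t = n}"

lemma initial_segment_iff: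
  fixes A :: "nat set"
  assumes "finite A"
  shows "(\<forall>k \<in> A. 0 < k) \<and> (\<forall>k \<in> A. {1..k - 1} \<subseteq> A) \<longleftrightarrow> (\<exists>m. A = {1..m})"
proof
  assume A: "(\<forall>k \<in> A. 0 < k) \<and> (\<forall>k \<in> A. {1..k - 1} \<subseteq> A)"
  show "\<exists>m. A = {1..m}"
  proof (cases "A = {}")
    case True
    then show ?thesis by (intro exI[of _ 0]) simp
  next
    case False
    then have M: "Max A \<in> A" using assms by simp
    have "A \<subseteq> {1..Max A}"
      using A assms by (force simp: Suc_le_eq)
    moreover have "{1..Max A} \<subseteq> insert (Max A) {1..Max A - 1}"
      by auto
    moreover have "\<dots> \<subseteq> A"
      using A M by blast
    ultimately show ?thesis by blast
  qed
next
  assume "\<exists>m. A = {1..m}"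
  then obtain m where "A = {1..m}" by blast
  then show "(\<forall>k \<in> A. 0 < k) \<and> (\<forall>k \<in> A. {1..k - 1} \<subseteq> A)" by auto
qed

lemma layered_trees_eq:
  "n \<ge> 2 \<Longrightarrow> layered_trees n = {t. weakly_increasing_binary_tree t \<and> size1 t = n}"
  unfolding layered_trees_def weakly_increasing_binary_tree_def sorted_branches_iff_increasing
  using initial_segment_iff[OF finite_set_tree] by auto

lemma layered_trees_0: "layered_trees 0 = {}"
  by (auto simp: layered_trees_def)

lemma layered_trees_1: "layered_trees 1 = {Leaf}"
proof -
  have "set_tree (Leaf :: nat tree) = {1..0}"
    by simp
  then have "Leaf \<in> layered_trees 1"
    unfolding layered_trees_def by auto
  moreover have "t = Leaf" if "size1 t = 1" for t :: "nat tree"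
    using that by (cases t) (auto simp: size1_size)
  ultimately show ?thesis
    unfolding layered_trees_def by blast
qed

lemma finite_layered_trees: "finite (layered_trees n)"
proof -
  consider "n = 0" | "n = 1" | "n \<ge> 2" by linarith
  then show ?thesis
    by cases (use layered_trees_0 layered_trees_1 layered_trees_eq
        finite_weakly_increasing_binary_trees in auto)
qed

text \<open>
  In an increasing tree with labels up to \<open>m\<close>, the children of a node labeled \<open>m\<close> are leaves, so cutting the
  tree at such a node deletes this node only.
\<close>

fun prune :: "nat \<Rightarrow> nat tree \<Rightarrow> nat tree" where
  "prune m Leaf = Leaf"
| "prune m (Node l a r) = (if a = m then Leaf else Node (prune m l) a (prune m r))"

text \<open>
  The trees that arise from \<open>s\<close> by replacing \<open>j\<close> leaves by nodes labeled \<open>m\<close>, described through the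
  inverse operation.
\<close>

definition extensions :: "nat \<Rightarrow> nat tree \<Rightarrow> nat \<Rightarrow> nat tree set" where
  "extensions m s j = {t. increasing_tree t \<and> set_tree t \<subseteq> {..m} \<and> prune m t = s
     \<and> size1 t = size1 s + j}"

lemma set_tree_prune:
  "increasing_tree t \<Longrightarrow> set_tree t \<subseteq> {..m} \<Longrightarrow> set_tree (prune m t) = set_tree t - {m}"
proof (induction t)
  case (Node l a r)
  have l: "increasing_tree l" "set_tree l \<subseteq> {..m}" "\<forall>x \<in> set_tree l. a < x"
    and r: "increasing_tree r" "set_tree r \<subseteq> {..m}" "\<forall>x \<in> set_tree r. a < x"
    and a: "a \<le> m"
    using Node.prems by auto
  show ?case
  proof (cases "a = m")
    case True
    then have "set_tree l = {}" "set_tree r = {}"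
      using l r by fastforce+
    then show ?thesis using True by simp
  next
    case False
    then show ?thesis using Node.IH l r by auto
  qed
qed simp

lemma increasing_tree_prune:
  "increasing_tree t \<Longrightarrow> set_tree t \<subseteq> {..m} \<Longrightarrow> increasing_tree (prune m t)"
proof (induction t)
  case (Node l a r)
  have l: "increasing_tree l" "set_tree l \<subseteq> {..m}" "\<forall>x \<in> set_tree l. a < x"
    and r: "increasing_tree r" "set_tree r \<subseteq> {..m}" "\<forall>x \<in> set_tree r. a < x"
    using Node.prems by auto
  show ?case
    using Node.IH l r set_tree_prune[OF l(1,2)] set_tree_prune[OF r(1,2)] by auto
qed simp

lemma size1_prune_le: "size1 (prune m t) \<le> size1 t"
  by (induction t) (auto simp: size1_size)

lemma size1_prune_less: "m \<in> set_tree t \<Longrightarrow> size1 (prune m t) < size1 t"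
proof (induction t)
  case (Node l a r)
  then show ?case
    using size1_prune_le[of m l] size1_prune_le[of m r]
    by (auto simp: size1_size)
qed simp

lemma extensions_Leaf:
  "extensions m Leaf j = (if j = 0 then {Leaf} else if j = 1 then {Node Leaf m Leaf} else {})"
proof -
  have root: "t = Leaf \<or> t = Node Leaf m Leaf"
    if t: "increasing_tree t" "set_tree t \<subseteq> {..m}" "prune m t = Leaf" for t
  proof (cases t)
    case (Node l a r)
    then have "a = m" using t by (auto split: if_splits)
    moreover have "x \<notin> set_tree l \<union> set_tree r" for x
      using t(1,2) unfolding Node \<open>a = m\<close>
      by (auto dest!: bspec[of _ _ x] subsetD[of _ _ x])
    then have "set_tree l \<union> set_tree r = {}"
      by blast
    ultimately show ?thesis using Node by simp
  qed simp
  have "t \<in> extensions m Leaf j \<longleftrightarrow> t = Leaf \<and> j = 0 \<or> t = Node Leaf m Leaf \<and> j = 1" for t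
    unfolding extensions_def using root[of t] by auto
  then show ?thesis
    by auto
qed

lemma extensions_Node:
  assumes "increasing_tree (Node l a r)" "set_tree (Node l a r) \<subseteq> {..<m}"
  shows "extensions m (Node l a r) j
    = (\<Union>i \<in> {..j}. (\<lambda>(x, y). Node x a y) ` (extensions m l i \<times> extensions m r (j - i)))"
proof (intro subset_antisym subsetI)
  fix t
  assume t: "t \<in> extensions m (Node l a r) j"
  then obtain x y where xy: "t = Node x a y" "prune m x = l" "prune m y = r"
    by (cases t) (auto simp: extensions_def split: if_splits)
  define i where "i = size1 x - size1 l"
  have "size1 l \<le> size1 x" "size1 r \<le> size1 y"
    using xy size1_prune_le by blast+
  then have "i \<le> j" "x \<in> extensions m l i" "y \<in> extensions m r (j - i)"
    using t xy by (auto simp: extensions_def i_def)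
  then show "t \<in> (\<Union>i \<in> {..j}. (\<lambda>(x, y). Node x a y) ` (extensions m l i \<times> extensions m r (j - i)))"
    using xy by auto
next
  fix t
  assume "t \<in> (\<Union>i \<in> {..j}. (\<lambda>(x, y). Node x a y) ` (extensions m l i \<times> extensions m r (j - i)))"
  then obtain i x y where *: "i \<le> j" "x \<in> extensions m l i" "y \<in> extensions m r (j - i)"
      "t = Node x a y"
    by auto
  have "set_tree x \<subseteq> insert m (set_tree l)" "set_tree y \<subseteq> insert m (set_tree r)"
    using * set_tree_prune[of x m] set_tree_prune[of y m] by (auto simp: extensions_def)
  then have "\<forall>z \<in> set_tree x \<union> set_tree y. a < z"
    using assms by auto
  then show "t \<in> extensions m (Node l a r) j"
    using * assms by (auto simp: extensions_def)
qed

text \<open>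
  The choice of \<open>j\<close> leaves splits into choices in the two subtrees, and Vandermonde's identity adds up
  the products.
\<close>

lemma card_extensions:
  assumes "increasing_tree s" "set_tree s \<subseteq> {..<m}"
  shows "finite (extensions m s j) \<and> card (extensions m s j) = size1 s choose j"
  using assms
proof (induction s arbitrary: j)
  case Leaf
  consider "j = 0" | "j = 1" | "j \<ge> 2" by linarith
  then show ?case
    by cases (auto simp: extensions_Leaf)
next
  case (Node l a r)
  let ?f = "\<lambda>(x, y). Node x a y"
  let ?X = "\<lambda>i. ?f ` (extensions m l i \<times> extensions m r (j - i))"
  have l: "finite (extensions m l i)" "card (extensions m l i) = size1 l choose i" for i
    using Node by auto
  have r: "finite (extensions m r i)" "card (extensions m r i) = size1 r choose i" for i
    using Node by auto
  have inj: "inj_on ?f A" for A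
    by (auto simp: inj_on_def)
  have disj: "?X i \<inter> ?X i' = {}" if "i \<noteq> i'" for i i'
    using that by (auto simp: extensions_def)
  have "card (\<Union>i \<in> {..j}. ?X i) = (\<Sum>i \<le> j. card (?X i))"
    using disj by (intro card_UN_disjoint) (auto simp: l r)
  also have "\<dots> = (\<Sum>i \<le> j. (size1 l choose i) * (size1 r choose (j - i)))"
    by (simp add: card_image[OF inj] card_cartesian_product l r)
  also have "\<dots> = (size1 l + size1 r) choose j"
    by (rule vandermonde)
  finally show ?case
    using extensions_Node[OF Node.prems, of j] by (simp add: l r)
qed

text \<open>
  The largest label of a layered tree is the number of its distinct labels, so it is one more than
  that of the pruned tree, and the trees with a given pruned tree \<open>s\<close> are extensions of \<open>s\<close> by one
  fixed label.
\<close>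

lemma fibre_prune:
  assumes s: "s \<in> layered_trees k" and "k < n"
  shows "{t \<in> layered_trees n. prune (card (set_tree t)) t = s}
       = extensions (Suc (card (set_tree s))) s (n - k)"
proof (intro subset_antisym subsetI)
  fix t
  assume "t \<in> {t \<in> layered_trees n. prune (card (set_tree t)) t = s}"
  then have "t \<in> layered_trees n" and p: "prune (card (set_tree t)) t = s"
    by auto
  then obtain m where t: "increasing_tree t" "set_tree t = {1..m}" "size1 t = n"
    unfolding layered_trees_def by blast
  then have t4: "prune m t = s"
    using p by simp
  have sub: "set_tree t \<subseteq> {..m}"
    using t(2) by auto
  have "set_tree s = {1..m} - {m}"
    using set_tree_prune[OF t(1) sub] t(2) t4 by simp
  moreover have "m \<noteq> 0"
  proof
    assume "m = 0"
    then have "t = Leaf" using t(2) by simp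
    then show False using t(3) t4 s \<open>k < n\<close> by (auto simp: layered_trees_def)
  qed
  ultimately have "Suc (card (set_tree s)) = m" by simp
  moreover have size1_s: "size1 s = k"
    using s by (simp add: layered_trees_def)
  ultimately show "t \<in> extensions (Suc (card (set_tree s))) s (n - k)"
    using t(1,3) t4 sub size1_s \<open>k < n\<close> by (simp add: extensions_def)
next
  fix t
  define m where "m = Suc (card (set_tree s))"
  assume "t \<in> extensions (Suc (card (set_tree s))) s (n - k)"
  then have t: "increasing_tree t" "set_tree t \<subseteq> {..m}" "prune m t = s" "size1 t = n"
    using s \<open>k < n\<close> by (auto simp: extensions_def m_def layered_trees_def)
  obtain i where i: "set_tree s = {1..i}" and s2: "size1 s = k"
    using s unfolding layered_trees_def by blast
  have s': "set_tree s = {1..m - 1}" "size1 s = k"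
    using i s2 by (simp_all add: m_def)
  have "m \<in> set_tree t"
  proof (rule ccontr)
    assume "m \<notin> set_tree t"
    moreover have "m \<notin> set_tree t \<Longrightarrow> prune m t = t"
      by (induction t) auto
    ultimately show False using t s' \<open>k < n\<close> by simp
  qed
  then have "set_tree t = insert m {1..m - 1}"
    using set_tree_prune[OF t(1,2)] t(3) s' by auto
  also have "\<dots> = {1..m}"
    by (auto simp: m_def)
  finally show "t \<in> {t \<in> layered_trees n. prune (card (set_tree t)) t = s}"
    using t unfolding layered_trees_def by auto
qed

lemma prune_layered:
  assumes t: "t \<in> layered_trees n" and n: "n \<ge> 2"
  shows "prune (card (set_tree t)) t \<in> (\<Union>k<n. layered_trees k)"
proof -
  obtain m where t: "increasing_tree t" "set_tree t = {1..m}" "set_tree t \<subseteq> {..m}" "size1 t = n"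
    using t by (auto simp: layered_trees_def)
  have "m \<noteq> 0"
    using t n by (cases t) auto
  have "set_tree (prune m t) = {1..m} - {m}"
    using set_tree_prune[OF t(1,3)] t(2) by simp
  also have "\<dots> = {1..m - 1}" by auto
  finally have "set_tree (prune m t) = {1..m - 1}" .
  moreover have "size1 (prune m t) < n"
    using size1_prune_less[of m t] t \<open>m \<noteq> 0\<close> by simp
  ultimately show ?thesis
    using increasing_tree_prune[OF t(1,3)] t(2) by (auto simp: layered_trees_def)
qed

definition tree_count :: "nat \<Rightarrow> nat" where
  "tree_count n = card (layered_trees n)"

text \<open>
  The terms with \<open>2 * k < n\<close> vanish: at most \<open>k\<close> leaves can be replaced.
\<close>

lemma tree_count_rec:
  assumes "n \<ge> 2"
  shows "tree_count n = (\<Sum>k<n. (k choose (n - k)) * tree_count k)"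
proof -
  let ?f = "\<lambda>t. prune (card (set_tree t)) t"
  have "tree_count n = (\<Sum>s \<in> (\<Union>k<n. layered_trees k). card {t \<in> layered_trees n. ?f t = s})"
    unfolding tree_count_def card_eq_sum
    by (rule sum.group[symmetric]) (use prune_layered assms finite_layered_trees in auto)
  also have "\<dots> = (\<Sum>k<n. \<Sum>s \<in> layered_trees k. card {t \<in> layered_trees n. ?f t = s})"
    by (rule sum.UNION_disjoint) (auto simp: finite_layered_trees, auto simp: layered_trees_def)
  also have "\<dots> = (\<Sum>k<n. \<Sum>s \<in> layered_trees k. k choose (n - k))"
  proof (intro sum.cong refl)
    fix k s assume ks: "k \<in> {..<n}" "s \<in> layered_trees k"
    have "increasing_tree s" "size1 s = k" "set_tree s \<subseteq> {..<Suc (card (set_tree s))}"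
      using ks by (auto simp: layered_trees_def)
    then show "card {t \<in> layered_trees n. ?f t = s} = k choose (n - k)"
      using fibre_prune[of s k n] ks card_extensions by auto
  qed
  finally show ?thesis by (simp add: tree_count_def mult.commute)
qed

lemma tree_count_0: "tree_count 0 = 0" and tree_count_1: "tree_count 1 = 1"
  using layered_trees_0 layered_trees_1 by (simp_all add: tree_count_def)

lemma B_eq_tree_count: "n \<ge> 2 \<Longrightarrow> B n = tree_count n"
  by (simp add: B_def tree_count_def layered_trees_eq)

section \<open>A Gamma integral that almost solves the recurrence\<close>

definition \<rho> :: real where "\<rho> = ln 2"

lemma rho_pos [simp]: "\<rho> > 0" and exp_rho: "exp \<rho> = 2" and rho_le_1: "\<rho> < 1"
  using ln_2_less_1 by (simp_all add: \<rho>_def)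

lemma rho_nonneg [simp]: "\<rho> \<ge> 0"
  using rho_pos by linarith

lemma rho_nonzero [simp]: "\<rho> \<noteq> 0"
  using rho_pos by linarith

lemma rho_bounds: "6931471805 / 10000000000 \<le> \<rho>" "\<rho> \<le> 6931471806 / 10000000000"
proof -
  have "\<rho> \<in> {6931471805 / 10000000000 .. 6931471806 / 10000000000}"
    using ln_approx_bounds[of 2 12] unfolding \<rho>_def
    by (simp add: eval_nat_numeral)
  then show "6931471805 / 10000000000 \<le> \<rho>" "\<rho> \<le> 6931471806 / 10000000000" by simp_all
qed

text \<open>
  These are the values of \<open>growth_op\<close> on \<open>\<lambda>k. t ^ k\<close>, up to the extra term \<open>t ^ n\<close>.  They are the
  coefficients of the power series of \<open>1 / (1 - t * (w + w\<^sup>2))\<close> in \<open>w\<close>.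
\<close>

definition growth_poly :: "nat \<Rightarrow> real \<Rightarrow> real" where
  "growth_poly n t = (\<Sum>k\<le>n. real (k choose (n - k)) * t ^ k)"

definition growth_op :: "(nat \<Rightarrow> real) \<Rightarrow> nat \<Rightarrow> real" where
  "growth_op f n = (\<Sum>k<n. real (k choose (n - k)) * f k)"

lemma growth_poly_rec:
  "growth_poly (Suc (Suc n)) t = t * (growth_poly (Suc n) t + growth_poly n t)"
proof -
  let ?c = "\<lambda>n k. real (k choose (n - k))"
  have "growth_poly (Suc (Suc n)) t = (\<Sum>j\<le>Suc n. real (Suc j choose (Suc n - j)) * t ^ Suc j)"
    unfolding growth_poly_def by (subst sum.atMost_Suc_shift) simp
  also have "\<dots> = (\<Sum>j\<le>n. real (Suc j choose Suc (n - j)) * t ^ Suc j) + t ^ Suc (Suc n)"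
    by (simp add: Suc_diff_le)
  also have "(\<Sum>j\<le>n. real (Suc j choose Suc (n - j)) * t ^ Suc j)
      = t * (\<Sum>j\<le>n. ?c n j * t ^ j) + t * (\<Sum>j\<le>n. real (j choose Suc (n - j)) * t ^ j)"
    by (simp add: sum_distrib_left sum.distrib algebra_simps)
  also have "(\<Sum>j\<le>n. real (j choose Suc (n - j)) * t ^ j) = (\<Sum>j\<le>n. ?c (Suc n) j * t ^ j)"
    by (intro sum.cong) (auto simp: Suc_diff_le)
  also have "t * (\<Sum>j\<le>n. ?c n j * t ^ j) + t * (\<Sum>j\<le>n. ?c (Suc n) j * t ^ j) + t ^ Suc (Suc n)
      = t * (growth_poly (Suc n) t + growth_poly n t)"
    by (simp add: growth_poly_def algebra_simps)
  finally show ?thesis .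
qed

text \<open>
  Inverse to taking the positive root \<open>x\<close> of the characteristic equation \<open>x\<^sup>2 = t * (1 + x)\<close>.
\<close>

definition \<tau> :: "real \<Rightarrow> real" where "\<tau> x = x\<^sup>2 / (1 + x)"

text \<open>
  The characteristic roots for \<open>t = \<tau> x\<close> are \<open>x\<close> and \<open>- x / (1 + x)\<close>, and the factor on the left is their
  difference.
\<close>

lemma growth_poly_Binet:
  assumes "x > 0"
  shows "x * (2 + x) / (1 + x) * growth_poly n (\<tau> x) = x ^ Suc n - (- x / (1 + x)) ^ Suc n"
proof (induction n rule: induct_nat_012)
  case 0
  show ?case using assms by (simp add: growth_poly_def field_simps)
next
  case 1
  show ?case using assms
    by (simp add: growth_poly_def \<tau>_def power2_eq_square divide_simps) algebra
next
  case (ge2 n)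
  define y where "y = - x / (1 + x)"
  have x2: "x\<^sup>2 = \<tau> x * (x + 1)" and y2: "y\<^sup>2 = \<tau> x * (y + 1)"
    using assms by (simp_all add: \<tau>_def y_def power2_eq_square field_simps)
  have "x * (2 + x) / (1 + x) * growth_poly (Suc (Suc n)) (\<tau> x)
      = \<tau> x * (x * (2 + x) / (1 + x) * growth_poly (Suc n) (\<tau> x)
          + x * (2 + x) / (1 + x) * growth_poly n (\<tau> x))"
    by (simp add: growth_poly_rec algebra_simps)
  also have "\<dots> = \<tau> x * (x ^ Suc (Suc n) - y ^ Suc (Suc n) + (x ^ Suc n - y ^ Suc n))"
    unfolding ge2 y_def by simp
  also have "\<dots> = x ^ Suc n * (\<tau> x * (x + 1)) - y ^ Suc n * (\<tau> x * (y + 1))"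
    by (simp add: algebra_simps)
  also have "\<dots> = x ^ Suc (Suc (Suc n)) - y ^ Suc (Suc (Suc n))"
    by (simp add: x2[symmetric] y2[symmetric] power2_eq_square)
  finally show ?case by (simp add: y_def)
qed

lemma tau_pos: "x > 0 \<Longrightarrow> \<tau> x > 0"
  by (simp add: \<tau>_def)

lemma tau_deriv:
  assumes "x > 0"
  shows "(\<tau> has_field_derivative x * (2 + x) / (1 + x)\<^sup>2) (at x within S)"
  unfolding \<tau>_def using assms
  by (auto intro!: derivative_eq_intros simp: power2_eq_square divide_simps) (simp_all add: algebra_simps)

lemma tau_strict_mono:
  assumes "0 < x" "x < y"
  shows "\<tau> x < \<tau> y"
proof -
  have "x\<^sup>2 * (1 + y) < y\<^sup>2 * (1 + x)"
  proof -
    have "x\<^sup>2 < y\<^sup>2" using assms by (simp add: power_strict_mono)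
    moreover have "x * y * x < x * y * y" using assms by simp
    ultimately show ?thesis by (simp add: algebra_simps power2_eq_square)
  qed
  then show ?thesis using assms by (simp add: \<tau>_def field_simps)
qed

lemma inj_on_tau: "inj_on \<tau> {0<..}"
  by (rule linorder_inj_onI') (use tau_strict_mono in force)

lemma image_tau: "\<tau> ` {0<..} = {0<..}"
proof (intro subset_antisym subsetI)
  fix t :: real assume "t \<in> {0<..}"
  then have t: "t > 0" by simp
  define r where "r = sqrt (t\<^sup>2 + 4 * t)"
  define x where "x = (t + r) / 2"
  have "r\<^sup>2 = t\<^sup>2 + 4 * t" "r \<ge> 0" using t by (simp_all add: r_def)
  then have "x\<^sup>2 = t * (1 + x)" by (simp add: x_def power2_eq_square field_simps)
  moreover have "x > 0" using t \<open>r \<ge> 0\<close> by (simp add: x_def add_pos_nonneg)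
  ultimately have "\<tau> x = t" "x > 0" by (simp_all add: \<tau>_def)
  then show "t \<in> \<tau> ` {0<..}" by force
qed (use tau_pos in auto)

definition kernel :: "real \<Rightarrow> real \<Rightarrow> real" where
  "kernel s t = t powr (- s) * exp (- \<rho> * t)"

text \<open>
  By \<open>moment_integral\<close>, the integral of \<open>kernel s t * t ^ (n - 1)\<close> over the positive reals.
\<close>

definition moment :: "real \<Rightarrow> nat \<Rightarrow> real" where
  "moment s n = Gamma (real n - s) / \<rho> powr (real n - s)"

lemma Gamma_integral_scaled:
  fixes z a :: real
  assumes "z > 0" "a > 0"
  shows "(\<lambda>t. t powr (z - 1) * exp (- a * t)) absolutely_integrable_on {0<..}"
    and "((\<lambda>t. t powr (z - 1) * exp (- a * t)) has_integral Gamma z / a powr z) {0<..}"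
proof -
  define f :: "real \<Rightarrow> real" where "f = (\<lambda>t. t powr (z - 1) / exp t)"
  have f: "(f has_integral Gamma z) {0<..}"
  proof -
    have "((\<lambda>t. if t \<in> {0<..} then f t else 0) has_integral Gamma z) {0..}"
      by (rule has_integral_spike[OF _ _ Gamma_integral_real[OF assms(1)], of "{0}"])
         (auto simp: f_def)
    then show ?thesis
      by (subst (asm) has_integral_restrict) auto
  qed
  have "f absolutely_integrable_on {0<..}"
    using f by (intro nonnegative_absolutely_integrable_1) (auto simp: f_def)
  moreover have im: "(\<lambda>t. a * t) ` {0<..} = {0<..}"
  proof (intro subset_antisym subsetI)
    fix x :: real assume "x \<in> {0<..}"
    then show "x \<in> (\<lambda>t. a * t) ` {0<..}"
      using assms by (intro image_eqI[of _ _ "x / a"]) auto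
  qed (use assms in auto)
  ultimately have *: "(\<lambda>t. \<bar>a\<bar> * f (a * t)) absolutely_integrable_on {0<..} \<and>
      integral {0<..} (\<lambda>t. \<bar>a\<bar> * f (a * t)) = Gamma z"
    using has_absolute_integral_change_of_variables_1'[of "{0<..}" "\<lambda>t. a * t" "\<lambda>_. a" f "Gamma z"]
      integral_unique[OF f] assms
    by (auto intro!: derivative_eq_intros simp: inj_on_def)
  have eq: "(1 / a powr z) * (\<bar>a\<bar> * f (a * t)) = t powr (z - 1) * exp (- a * t)" if "t \<in> {0<..}" for t
    using that assms by (simp add: f_def powr_mult exp_minus powr_diff field_simps)
  have "(\<lambda>t. (1 / a powr z) * (\<bar>a\<bar> * f (a * t))) absolutely_integrable_on {0<..}"
    using * by (intro set_integrable_mult_right) auto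
  then show int: "(\<lambda>t. t powr (z - 1) * exp (- a * t)) absolutely_integrable_on {0<..}"
    using eq by (subst (asm) set_integrable_cong[OF refl refl]) auto
  have "((\<lambda>t. \<bar>a\<bar> * f (a * t)) has_integral Gamma z) {0<..}"
    using * set_lebesgue_integral_eq_integral(1) by (metis has_integral_iff)
  then have "((\<lambda>t. (1 / a powr z) * (\<bar>a\<bar> * f (a * t))) has_integral (1 / a powr z) * Gamma z) {0<..}"
    by (rule has_integral_mult_right)
  then show "((\<lambda>t. t powr (z - 1) * exp (- a * t)) has_integral Gamma z / a powr z) {0<..}"
    using eq by (subst (asm) has_integral_cong) auto
qed

lemma moment_integral:
  assumes "real n > s" "n \<ge> 1"
  shows "(\<lambda>t. kernel s t * t ^ (n - 1)) absolutely_integrable_on {0<..}"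
    and "((\<lambda>t. kernel s t * t ^ (n - 1)) has_integral moment s n) {0<..}"
proof -
  have eq: "t powr (real n - s - 1) * exp (- \<rho> * t) = kernel s t * t ^ (n - 1)" if "t \<in> {0<..}" for t
  proof -
    have "t powr (real n - s - 1) = t powr (- s + real (n - 1))"
      using assms by (simp add: of_nat_diff algebra_simps)
    also have "\<dots> = t powr (- s) * t ^ (n - 1)"
      using that by (simp only: powr_add powr_realpow greaterThan_iff)
    finally show ?thesis by (simp add: kernel_def mult_ac)
  qed
  have pos: "real n - s > 0" using assms by simp
  show "(\<lambda>t. kernel s t * t ^ (n - 1)) absolutely_integrable_on {0<..}"
    using Gamma_integral_scaled(1)[OF pos rho_pos] eq
    by (subst (asm) set_integrable_cong[OF refl refl]) auto
  show "((\<lambda>t. kernel s t * t ^ (n - 1)) has_integral moment s n) {0<..}"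
    using Gamma_integral_scaled(2)[OF pos rho_pos] eq
    by (subst (asm) has_integral_cong) (auto simp: moment_def)
qed

text \<open>
  Under \<open>t = \<tau> x\<close>, the measure \<open>growth_poly n t / t * dt\<close> becomes
  \<open>(x ^ (n - 1) - (-1) ^ (n + 1) * x ^ (n - 1) / (1 + x) ^ (n + 1)) * dx\<close> because the Jacobian cancels the
  difference of the roots in Binet's formula.  The second term belongs to the root of
  modulus less than 1.  The summands with small \<open>k\<close>, whose integrals diverge, carry the binomial
  coefficient 0; this is where \<open>2 * s < n\<close> enters.
\<close>

lemma growth_op_moment_integral:
  assumes "2 * s < real n" "s \<ge> 0" "n \<ge> 1"
  shows "((\<lambda>x. kernel s (\<tau> x) * x ^ (n - 1) * (1 - (-1) ^ Suc n / (1 + x) ^ Suc n))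
           has_integral growth_op (moment s) n + moment s n) {0<..}"
proof -
  define f where "f = (\<lambda>t. \<Sum>k\<le>n. real (k choose (n - k)) * (kernel s t * t ^ (k - 1)))"
  have summand: "(\<lambda>t. real (k choose (n - k)) * (kernel s t * t ^ (k - 1))) absolutely_integrable_on {0<..}"
      "((\<lambda>t. real (k choose (n - k)) * (kernel s t * t ^ (k - 1)))
         has_integral real (k choose (n - k)) * moment s k) {0<..}" if "k \<le> n" for k
  proof -
    have "(\<lambda>t. real (k choose (n - k)) * (kernel s t * t ^ (k - 1))) absolutely_integrable_on {0<..} \<and>
        ((\<lambda>t. real (k choose (n - k)) * (kernel s t * t ^ (k - 1)))
           has_integral real (k choose (n - k)) * moment s k) {0<..}"
    proof (cases "n - k \<le> k")
      case True
      then have "real k > s" "k \<ge> 1" using assms that by linarith+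
      then show ?thesis
        using moment_integral[of s k] by (intro conjI set_integrable_mult_right has_integral_mult_right) auto
    next
      case False
      then show ?thesis by (simp add: binomial_eq_0)
    qed
    then show "(\<lambda>t. real (k choose (n - k)) * (kernel s t * t ^ (k - 1))) absolutely_integrable_on {0<..}"
      "((\<lambda>t. real (k choose (n - k)) * (kernel s t * t ^ (k - 1)))
         has_integral real (k choose (n - k)) * moment s k) {0<..}" by blast+
  qed
  have abs: "f absolutely_integrable_on {0<..}"
    unfolding f_def using summand by (intro absolutely_integrable_sum) auto
  have "(f has_integral (\<Sum>k\<le>n. real (k choose (n - k)) * moment s k)) {0<..}"
    unfolding f_def using summand by (intro has_integral_sum) auto
  also have "(\<Sum>k\<le>n. real (k choose (n - k)) * moment s k) = growth_op (moment s) n + moment s n"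
    by (simp add: growth_op_def lessThan_Suc_atMost[symmetric])
  finally have int: "(f has_integral (growth_op (moment s) n + moment s n)) {0<..}" .
  have "(\<lambda>x. \<bar>x * (2 + x) / (1 + x)\<^sup>2\<bar> * f (\<tau> x)) absolutely_integrable_on {0<..} \<and>
     integral {0<..} (\<lambda>x. \<bar>x * (2 + x) / (1 + x)\<^sup>2\<bar> * f (\<tau> x)) = growth_op (moment s) n + moment s n"
    using has_absolute_integral_change_of_variables_1'[of "{0<..}" \<tau> "\<lambda>x. x * (2 + x) / (1 + x)\<^sup>2" f]
      tau_deriv inj_on_tau image_tau abs integral_unique[OF int] by auto
  then have "((\<lambda>x. \<bar>x * (2 + x) / (1 + x)\<^sup>2\<bar> * f (\<tau> x)) has_integral growth_op (moment s) n + moment s n) {0<..}"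
    using set_lebesgue_integral_eq_integral(1) by (metis has_integral_iff)
  moreover have "\<bar>x * (2 + x) / (1 + x)\<^sup>2\<bar> * f (\<tau> x)
      = kernel s (\<tau> x) * x ^ (n - 1) * (1 - (-1) ^ Suc n / (1 + x) ^ Suc n)" if "x \<in> {0<..}" for x
  proof -
    have x: "x > 0" using that by simp
    have "\<tau> x * f (\<tau> x) = kernel s (\<tau> x) * growth_poly n (\<tau> x)"
      unfolding f_def growth_poly_def sum_distrib_left
    proof (intro sum.cong refl)
      fix k
      have "\<tau> x * \<tau> x ^ (k - 1) = \<tau> x ^ k \<or> k = 0" by (cases k) auto
      then show "\<tau> x * (real (k choose (n - k)) * (kernel s (\<tau> x) * \<tau> x ^ (k - 1)))
          = kernel s (\<tau> x) * (real (k choose (n - k)) * \<tau> x ^ k)"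
        using assms by (cases "k = 0") (auto simp: mult_ac)
    qed
    then have f: "f (\<tau> x) = kernel s (\<tau> x) * growth_poly n (\<tau> x) / \<tau> x"
      using tau_pos[OF x] by (simp add: field_simps)
    have "x * (2 + x) / (1 + x)\<^sup>2 * (growth_poly n (\<tau> x) / \<tau> x)
        = (x * (2 + x) / (1 + x) * growth_poly n (\<tau> x)) / x\<^sup>2"
    proof -
      have "x \<noteq> 0" "1 + x \<noteq> 0" using x by auto
      then show ?thesis by (simp add: \<tau>_def power2_eq_square)
    qed
    also have "\<dots> = (x ^ Suc n - (- x / (1 + x)) ^ Suc n) / x\<^sup>2"
      by (simp only: growth_poly_Binet[OF x])
    also have "(- x / (1 + x)) ^ Suc n = x ^ Suc n * ((-1) ^ Suc n / (1 + x) ^ Suc n)"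
      by (simp only: power_divide power_minus[of x] mult_ac times_divide_eq_right)
    also have "(x ^ Suc n - x ^ Suc n * ((-1) ^ Suc n / (1 + x) ^ Suc n)) / x\<^sup>2
        = x ^ Suc n / x\<^sup>2 * (1 - (-1) ^ Suc n / (1 + x) ^ Suc n)"
    proof -
      have "(X - X * Y) / Z = X / Z * (1 - Y)" for X Y Z :: real
        by (simp add: right_diff_distrib diff_divide_distrib)
      then show ?thesis .
    qed
    also have "x ^ Suc n / x\<^sup>2 = x ^ (n - 1)"
      using x assms by (cases n) (auto simp: power2_eq_square)
    finally have key: "x * (2 + x) / (1 + x)\<^sup>2 * (growth_poly n (\<tau> x) / \<tau> x)
        = x ^ (n - 1) * (1 - (-1) ^ Suc n / (1 + x) ^ Suc n)" .
    have "\<bar>x * (2 + x) / (1 + x)\<^sup>2\<bar> * f (\<tau> x)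
        = kernel s (\<tau> x) * (x * (2 + x) / (1 + x)\<^sup>2 * (growth_poly n (\<tau> x) / \<tau> x))"
      using x by (simp add: f)
    then show ?thesis by (simp only: key mult.assoc)
  qed
  ultimately show ?thesis
    by (subst (asm) has_integral_cong) auto
qed
text \<open>
  Bounds the contribution of the smaller root to \<open>growth_op_moment_integral\<close>, uniformly in \<open>n\<close>: the
  powers of \<open>x\<close> and \<open>1 + x\<close> combine to at most \<open>(1 + x) powr (- 2 - s)\<close>, and \<open>\<tau> x \<ge> x - 1\<close> controls the
  exponential.
\<close>

lemma kernel_tau_error:
  assumes "x > 0" "s \<ge> 0" "real n \<ge> 1 + 2 * s"
  shows "kernel s (\<tau> x) * x ^ (n - 1) / (1 + x) ^ Suc n \<le> 2 * exp (- \<rho> * x)"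
proof -
  have n1: "n \<ge> 1" using assms by linarith
  have "\<tau> x \<ge> x - 1"
    using assms by (simp add: \<tau>_def field_simps power2_eq_square)
  then have "exp (- \<rho> * \<tau> x) \<le> exp (- \<rho> * x + \<rho>)"
    using mult_left_mono[of "x - 1" "\<tau> x" \<rho>] rho_pos by (simp add: algebra_simps)
  also have "\<dots> = 2 * exp (- \<rho> * x)"
    by (simp only: exp_add exp_rho)
  finally have 1: "exp (- \<rho> * \<tau> x) \<le> 2 * exp (- \<rho> * x)" .
  have "\<tau> x powr (- s) * x ^ (n - 1) / (1 + x) ^ Suc n
      = x powr (real n - 1 - 2 * s) * (1 + x) powr (s - real n - 1)"
  proof -
    have "\<tau> x powr (- s) = x powr (- 2 * s) * (1 + x) powr s"
    proof -
      have "\<tau> x powr (- s) = (x powr 2) powr (- s) / (1 + x) powr (- s)"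
        using assms by (simp add: \<tau>_def powr_divide)
      then show ?thesis by (simp only: powr_powr powr_minus) (simp add: field_simps powr_minus)
    qed
    moreover have "x ^ (n - 1) = x powr (real n - 1)"
      using assms n1 by (simp add: powr_realpow[symmetric] of_nat_diff)
    moreover have "(1 + x) ^ Suc n = (1 + x) powr (real n + 1)"
      using assms powr_realpow[of "1 + x" "Suc n"] by (simp add: add.commute)
    moreover have "x powr (real n - 1 - 2 * s) = x powr (- 2 * s) * x powr (real n - 1)"
      by (simp add: powr_add[symmetric])
    moreover have "(1 + x) powr (s - real n - 1) = (1 + x) powr s / (1 + x) powr (real n + 1)"
      by (simp add: powr_diff[symmetric] algebra_simps)
    ultimately show ?thesis by simp
  qed
  also have "\<dots> \<le> (1 + x) powr (real n - 1 - 2 * s) * (1 + x) powr (s - real n - 1)"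
    using assms by (intro mult_right_mono powr_mono2) auto
  also have "\<dots> = (1 + x) powr (- 2 - s)"
  proof -
    have "real n - 1 - 2 * s + (s - real n - 1) = - 2 - s" by simp
    then show ?thesis by (simp only: powr_add[symmetric])
  qed
  also have "\<dots> \<le> (1 + x) powr 0"
    using assms by (intro powr_mono) auto
  finally have 2: "\<tau> x powr (- s) * x ^ (n - 1) / (1 + x) ^ Suc n \<le> 1"
    using assms by simp
  have "kernel s (\<tau> x) * x ^ (n - 1) / (1 + x) ^ Suc n
      = exp (- \<rho> * \<tau> x) * (\<tau> x powr (- s) * x ^ (n - 1) / (1 + x) ^ Suc n)"
    by (simp add: kernel_def mult_ac)
  also have "\<dots> \<le> 2 * exp (- \<rho> * x) * 1"
    using assms 1 2 by (intro mult_mono) auto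
  finally show ?thesis by simp
qed

text \<open>
  Integration of the pointwise inequality against \<open>x ^ (n - 1)\<close>.  The additive constant is the
  integral of the bound \<open>kernel_tau_error\<close>.  Negating all \<open>c j\<close> gives the reversed statement.
\<close>

lemma growth_op_le:
  fixes c :: "nat \<Rightarrow> real"
  assumes n: "n \<ge> 2 * m + 1"
    and E: "\<And>x. x > 0 \<Longrightarrow> (\<Sum>j<m. c j * kernel (\<rho> + j) (\<tau> x)) \<le> 2 * (\<Sum>j<m. c j * kernel (\<rho> + j) x)"
  defines "g \<equiv> \<lambda>k. \<Sum>j<m. c j * moment (\<rho> + j) k"
  shows "growth_op g n \<le> g n + 2 / \<rho> * (\<Sum>j<m. \<bar>c j\<bar>)"
proof -
  define \<sigma> where "\<sigma> = (\<lambda>x::real. (-1) ^ Suc n / (1 + x) ^ Suc n)"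
  define R where "R = (\<lambda>x. 2 * (\<Sum>j<m. c j * (kernel (\<rho> + j) x * x ^ (n - 1)))
      + (\<Sum>j<m. \<bar>c j\<bar>) * (2 * (x powr (1 - 1) * exp (- \<rho> * x))))"
  have s: "2 * (\<rho> + real j) < real n" "real n \<ge> 1 + 2 * (\<rho> + real j)" "\<rho> + real j < real n"
      "\<rho> + real j \<ge> 0" if "j < m" for j
  proof -
    have *: "real n \<ge> 2 * real m + 1" "real j + 1 \<le> real m" "real j \<ge> 0"
      using n that by linarith+
    have **: "2 * (\<rho> + real j) = 2 * \<rho> + 2 * real j" by simp
    show "2 * (\<rho> + real j) < real n" unfolding ** using * rho_le_1 by linarith
    show "real n \<ge> 1 + 2 * (\<rho> + real j)" unfolding ** using * rho_le_1 by linarith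
    show "\<rho> + real j < real n" using * rho_le_1 by linarith
    show "\<rho> + real j \<ge> 0" by simp
  qed
  have n1: "n \<ge> 1" using n by simp
  have "((\<lambda>x. \<Sum>j<m. c j * (kernel (\<rho> + j) (\<tau> x) * x ^ (n - 1) * (1 - \<sigma> x)))
      has_integral (\<Sum>j<m. c j * (growth_op (moment (\<rho> + j)) n + moment (\<rho> + j) n))) {0<..}"
    unfolding \<sigma>_def using s n1
    by (intro has_integral_sum has_integral_mult_right growth_op_moment_integral) auto
  moreover have "(\<Sum>j<m. c j * (growth_op (moment (\<rho> + j)) n + moment (\<rho> + j) n)) = growth_op g n + g n"
  proof -
    have "growth_op g n = (\<Sum>j<m. c j * growth_op (moment (\<rho> + j)) n)"
      unfolding g_def growth_op_def sum_distrib_left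
      by (subst sum.swap) (simp add: mult_ac)
    then show ?thesis by (simp add: g_def sum.distrib distrib_left)
  qed
  ultimately have L: "((\<lambda>x. \<Sum>j<m. c j * (kernel (\<rho> + j) (\<tau> x) * x ^ (n - 1) * (1 - \<sigma> x)))
      has_integral growth_op g n + g n) {0<..}" by simp
  have "(R has_integral 2 * (\<Sum>j<m. c j * moment (\<rho> + j) n)
      + (\<Sum>j<m. \<bar>c j\<bar>) * (2 * (Gamma 1 / \<rho> powr 1))) {0<..}"
    unfolding R_def using s n1
    by (intro has_integral_add has_integral_mult_right has_integral_sum moment_integral
        Gamma_integral_scaled) auto
  then have R: "(R has_integral 2 * g n + 2 / \<rho> * (\<Sum>j<m. \<bar>c j\<bar>)) {0<..}"
    by (simp add: g_def mult_ac)
  have "growth_op g n + g n \<le> 2 * g n + 2 / \<rho> * (\<Sum>j<m. \<bar>c j\<bar>)"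
  proof (rule has_integral_le[OF L R])
    fix x :: real assume "x \<in> {0<..}"
    then have x: "x > 0" by simp
    have "c j * (kernel (\<rho> + j) (\<tau> x) * x ^ (n - 1) * (1 - \<sigma> x))
        \<le> c j * kernel (\<rho> + j) (\<tau> x) * x ^ (n - 1) + \<bar>c j\<bar> * (2 * exp (- \<rho> * x))"
      if "j < m" for j
    proof -
      have "\<bar>kernel (\<rho> + j) (\<tau> x) * x ^ (n - 1) * \<sigma> x\<bar>
          = kernel (\<rho> + j) (\<tau> x) * x ^ (n - 1) / (1 + x) ^ Suc n"
        using x by (simp add: \<sigma>_def abs_mult power_abs kernel_def)
      also have "\<dots> \<le> 2 * exp (- \<rho> * x)"
        using s[OF that] x by (intro kernel_tau_error) auto
      finally have "\<bar>c j\<bar> * \<bar>kernel (\<rho> + j) (\<tau> x) * x ^ (n - 1) * \<sigma> x\<bar> \<le> \<bar>c j\<bar> * (2 * exp (- \<rho> * x))"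
        by (rule mult_left_mono) simp
      moreover have "- (c j * (kernel (\<rho> + j) (\<tau> x) * x ^ (n - 1) * \<sigma> x))
          \<le> \<bar>c j\<bar> * \<bar>kernel (\<rho> + j) (\<tau> x) * x ^ (n - 1) * \<sigma> x\<bar>"
        by (metis abs_ge_minus_self abs_mult)
      ultimately show ?thesis by (simp add: algebra_simps)
    qed
    then have "(\<Sum>j<m. c j * (kernel (\<rho> + j) (\<tau> x) * x ^ (n - 1) * (1 - \<sigma> x)))
        \<le> (\<Sum>j<m. c j * kernel (\<rho> + j) (\<tau> x) * x ^ (n - 1) + \<bar>c j\<bar> * (2 * exp (- \<rho> * x)))"
      by (intro sum_mono) auto
    also have "\<dots> = (\<Sum>j<m. c j * kernel (\<rho> + j) (\<tau> x)) * x ^ (n - 1) + (\<Sum>j<m. \<bar>c j\<bar>) * (2 * exp (- \<rho> * x))"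
      by (simp only: sum.distrib sum_distrib_right)
    also have "\<dots> \<le> 2 * (\<Sum>j<m. c j * kernel (\<rho> + j) x) * x ^ (n - 1) + (\<Sum>j<m. \<bar>c j\<bar>) * (2 * exp (- \<rho> * x))"
      using E[OF x] x by (intro add_mono mult_right_mono) auto
    also have "\<dots> = R x"
      using x by (simp add: R_def sum_distrib_left sum_distrib_right mult_ac)
    finally show "(\<Sum>j<m. c j * (kernel (\<rho> + j) (\<tau> x) * x ^ (n - 1) * (1 - \<sigma> x))) \<le> R x" .
  qed
  then show ?thesis by simp
qed

section \<open>Upper and lower models\<close>

text \<open>
  The kernel \<open>exp (- \<rho> * x) * x powr (- \<rho>)\<close> fails to satisfy \<open>E(\<tau> x) = 2 * E(x)\<close> by the factor
  \<open>exp (\<rho> * \<delta> (1 / x))\<close>.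
\<close>

definition \<delta> :: "real \<Rightarrow> real" where "\<delta> u = ln (1 + u) - u / (1 + u)"

lemma \<delta>_deriv:
  assumes "u \<ge> 0"
  shows "(\<delta> has_real_derivative u / (1 + u)\<^sup>2) (at u)"
proof -
  have "(\<delta> has_real_derivative 1 / (1 + u) - (1 * (1 + u) - u * 1) / ((1 + u) * (1 + u))) (at u)"
    unfolding \<delta>_def using assms by (auto intro!: derivative_eq_intros)
  moreover have "1 / (1 + u) - (1 * (1 + u) - u * 1) / ((1 + u) * (1 + u)) = u / (1 + u)\<^sup>2"
    using assms by (simp add: power2_eq_square divide_simps)
  ultimately show ?thesis by simp
qed

lemma \<delta>_le: "u \<ge> 0 \<Longrightarrow> \<delta> u \<le> u\<^sup>2 / 2"
proof -
  assume u: "u \<ge> 0"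
  have "(\<lambda>u. u\<^sup>2 / 2 - \<delta> u) 0 \<le> (\<lambda>u. u\<^sup>2 / 2 - \<delta> u) u"
  proof (rule DERIV_nonneg_imp_nondecreasing[OF u])
    fix x :: real assume x: "0 \<le> x" "x \<le> u"
    have "x / (1 + x)\<^sup>2 \<le> x / 1"
      using x by (intro divide_left_mono) auto
    then show "\<exists>y. ((\<lambda>u. u\<^sup>2 / 2 - \<delta> u) has_real_derivative y) (at x) \<and> 0 \<le> y"
      using x by (intro exI[of _ "x - x / (1 + x)\<^sup>2"]) (auto intro!: derivative_eq_intros \<delta>_deriv)
  qed
  then show ?thesis by (simp add: \<delta>_def)
qed

lemma \<delta>_ge: "u \<ge> 0 \<Longrightarrow> \<delta> u \<ge> u\<^sup>2 / 2 - 2 / 3 * u ^ 3"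
proof -
  assume u: "u \<ge> 0"
  have "(\<lambda>u. \<delta> u - (u\<^sup>2 / 2 - 2 / 3 * u ^ 3)) 0 \<le> (\<lambda>u. \<delta> u - (u\<^sup>2 / 2 - 2 / 3 * u ^ 3)) u"
  proof (rule DERIV_nonneg_imp_nondecreasing[OF u])
    fix x :: real assume x: "0 \<le> x" "x \<le> u"
    have "(x - 2 * x\<^sup>2) * (1 + x)\<^sup>2 = x - (3 * x ^ 3 + 2 * x ^ 4)"
      by (simp add: power2_eq_square power3_eq_cube power4_eq_xxxx algebra_simps)
    also have "\<dots> \<le> x"
      using zero_le_power[OF x(1), of 3] zero_le_power[OF x(1), of 4] by linarith
    finally have "x - 2 * x\<^sup>2 \<le> x / (1 + x)\<^sup>2"
      using x by (simp add: field_simps)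
    then show "\<exists>y. ((\<lambda>u. \<delta> u - (u\<^sup>2 / 2 - 2 / 3 * u ^ 3)) has_real_derivative y) (at x) \<and> 0 \<le> y"
      using x by (intro exI[of _ "x / (1 + x)\<^sup>2 - (x - 2 * x\<^sup>2)"])
        (auto intro!: derivative_eq_intros \<delta>_deriv)
  qed
  then show ?thesis by (simp add: \<delta>_def)
qed

lemma \<delta>_nonneg: "u \<ge> 0 \<Longrightarrow> \<delta> u \<ge> 0"
proof -
  assume u: "u \<ge> 0"
  have "\<delta> 0 \<le> \<delta> u"
    by (rule DERIV_nonneg_imp_nondecreasing[OF u]) (use \<delta>_deriv in force)
  then show ?thesis by (simp add: \<delta>_def)
qed

text \<open>
  In terms of \<open>u = 1 / x\<close> the map \<open>\<tau>\<close> becomes \<open>u \<mapsto> u + u\<^sup>2\<close>, since \<open>1 / \<tau> x = (1 + x) / x\<^sup>2\<close>.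
\<close>

lemma kernel_tau:
  assumes "x > 0"
  shows "kernel (\<rho> + real j) x = exp (- \<rho> * x) * x powr (- \<rho>) * (1 / x) ^ j"
    and "kernel (\<rho> + real j) (\<tau> x)
       = 2 * (exp (- \<rho> * x) * x powr (- \<rho>)) * (exp (\<rho> * \<delta> (1 / x)) * (1 / x + (1 / x)\<^sup>2) ^ j)"
proof -
  have split: "kernel (\<rho> + real j) y = exp (- \<rho> * y) * y powr (- \<rho>) * (1 / y) ^ j" if "y > 0" for y
  proof -
    have "y powr (- (\<rho> + real j)) = y powr (- \<rho>) / y powr (real j)"
      by (simp add: powr_diff[symmetric])
    then show ?thesis using that by (simp add: kernel_def powr_realpow power_one_over)
  qed
  show "kernel (\<rho> + real j) x = exp (- \<rho> * x) * x powr (- \<rho>) * (1 / x) ^ j"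
    by (rule split[OF assms])
  have "exp (- \<rho> * \<tau> x) = exp (- \<rho> * x + \<rho> - \<rho> * ((1 / x) / (1 + 1 / x)))"
  proof -
    define w where "w = (1 / x) / (1 + 1 / x)"
    have "\<tau> x = x - 1 + w"
      using assms by (simp add: w_def \<tau>_def power2_eq_square field_simps)
    then have "- \<rho> * \<tau> x = - \<rho> * x + \<rho> - \<rho> * w"
      by (simp only:) (simp add: algebra_simps)
    then show ?thesis by (simp only: w_def)
  qed
  also have "\<dots> = 2 * exp (- \<rho> * x) * exp (- \<rho> * ((1 / x) / (1 + 1 / x)))"
    by (simp only: diff_conv_add_uminus exp_add exp_rho mult_minus_left)
  finally have 1: "exp (- \<rho> * \<tau> x) = \<dots>" .
  have "\<tau> x = x / (1 + 1 / x)"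
    using assms by (simp add: \<tau>_def power2_eq_square field_simps)
  then have "\<tau> x powr (- \<rho>) = (x / (1 + 1 / x)) powr (- \<rho>)"
    by simp
  also have "\<dots> = x powr (- \<rho>) * (1 + 1 / x) powr \<rho>"
  proof -
    have "(x / y) powr (- \<rho>) = x powr (- \<rho>) * y powr \<rho>" if "y > 0" for y
      using that assms by (simp add: powr_divide powr_minus_divide)
    moreover have "1 + 1 / x > 0" using assms by (intro add_pos_pos) auto
    ultimately show ?thesis by blast
  qed
  also have "(1 + 1 / x) powr \<rho> = exp (\<rho> * ln (1 + 1 / x))"
  proof -
    have "1 + 1 / x > 0" using assms by (intro add_pos_pos) auto
    then show ?thesis by (simp add: powr_def)
  qed
  finally have 2: "\<tau> x powr (- \<rho>) = x powr (- \<rho>) * exp (\<rho> * ln (1 + 1 / x))" .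
  have 3: "1 / \<tau> x = 1 / x + (1 / x)\<^sup>2"
    using assms by (simp add: \<tau>_def power2_eq_square field_simps)
  have 4: "exp (\<rho> * \<delta> (1 / x)) = exp (- \<rho> * ((1 / x) / (1 + 1 / x))) * exp (\<rho> * ln (1 + 1 / x))"
    by (simp add: \<delta>_def exp_add[symmetric] algebra_simps)
  show "kernel (\<rho> + real j) (\<tau> x)
       = 2 * (exp (- \<rho> * x) * x powr (- \<rho>)) * (exp (\<rho> * \<delta> (1 / x)) * (1 / x + (1 / x)\<^sup>2) ^ j)"
    unfolding split[OF tau_pos[OF assms]] 1 2 3 4 by (simp only: mult_ac)
qed

text \<open>
  With \<open>exp (- y) \<ge> 1 - y\<close> and \<open>\<delta> u \<le> u\<^sup>2 / 2\<close> the second-order terms cancel exactly; only a nonnegative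
  mixed term is left.  If the left-hand side is not positive, the estimate is immediate from
  \<open>\<delta> u \<ge> 0\<close>.
\<close>

lemma upper_pointwise:
  assumes "u > 0"
  shows "exp (\<rho> * \<delta> u) * (1 - \<rho> / 2 * (u + u\<^sup>2)) \<le> 1 - \<rho> / 2 * u"
proof (cases "1 - \<rho> / 2 * (u + u\<^sup>2) \<le> 0")
  case True
  have "exp (\<rho> * \<delta> u) \<ge> 1"
    using \<delta>_nonneg[of u] assms by simp
  then have "exp (\<rho> * \<delta> u) * (1 - \<rho> / 2 * (u + u\<^sup>2)) \<le> 1 * (1 - \<rho> / 2 * (u + u\<^sup>2))"
    using True by (rule mult_right_mono_neg)
  also have "\<dots> \<le> 1 - \<rho> / 2 * u"
    using assms by (simp add: algebra_simps)
  finally show ?thesis .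
next
  case False
  have "1 - \<rho> / 2 * (u + u\<^sup>2) \<le> (1 - \<rho> / 2 * u) * (1 - \<rho> * \<delta> u)"
  proof -
    have 1: "\<rho> * \<delta> u \<le> \<rho> * (u\<^sup>2 / 2)"
      using \<delta>_le[of u] assms by (intro mult_left_mono) auto
    have 2: "\<rho> / 2 * u * (\<rho> * \<delta> u) \<ge> 0"
      using \<delta>_nonneg[of u] assms by simp
    have 3: "(1 - \<rho> / 2 * u) * (1 - A) = 1 - \<rho> / 2 * u - A + \<rho> / 2 * u * A" for A
      by (simp add: field_simps)
    have 4: "\<rho> / 2 * (u + u\<^sup>2) = \<rho> / 2 * u + \<rho> * (u\<^sup>2 / 2)"
      by (simp add: field_simps)
    show ?thesis unfolding 3 4 using 1 2 by linarith
  qed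
  also have "\<dots> \<le> (1 - \<rho> / 2 * u) * exp (- (\<rho> * \<delta> u))"
  proof (rule mult_left_mono)
    show "1 - \<rho> * \<delta> u \<le> exp (- (\<rho> * \<delta> u))"
      using exp_ge_add_one_self[of "- (\<rho> * \<delta> u)"] by simp
    have "\<rho> / 2 * u \<le> \<rho> / 2 * (u + u\<^sup>2)"
      by (intro mult_left_mono) auto
    then show "0 \<le> 1 - \<rho> / 2 * u" using False by linarith
  qed
  finally have "exp (\<rho> * \<delta> u) * (1 - \<rho> / 2 * (u + u\<^sup>2))
      \<le> exp (\<rho> * \<delta> u) * ((1 - \<rho> / 2 * u) * exp (- (\<rho> * \<delta> u)))"
    by (intro mult_left_mono) auto
  also have "\<dots> = 1 - \<rho> / 2 * u"
    by (simp add: exp_minus)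
  finally show ?thesis .
qed

text \<open>
  Up to \<open>u = 1\<close> the difference, with \<open>exp y \<ge> 1 + y\<close> and the cubic lower bound for \<open>\<delta>\<close>, is a polynomial
  divisible by \<open>u ^ 3\<close>.  Its leading coefficient is \<open>7 / 12 - 2 / 3 * \<rho> - \<rho>\<^sup>2 / 4\<close>, which is positive but less than
  \<open>0.002\<close>.  Beyond \<open>u = 1\<close> the quadratic polynomial has already grown from \<open>u\<close> to \<open>u + u\<^sup>2\<close>.
\<close>

lemma lower_pointwise:
  assumes u: "u > 0"
  shows "1 - \<rho> / 2 * u + 7 / 24 * u\<^sup>2
     \<le> exp (\<rho> * \<delta> u) * (1 - \<rho> / 2 * (u + u\<^sup>2) + 7 / 24 * (u + u\<^sup>2)\<^sup>2)"
proof -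
  define v where "v = u + u\<^sup>2"
  define P where "P = (\<lambda>z. 1 - \<rho> / 2 * z + 7 / 24 * z\<^sup>2)"
  have P_pos: "P z \<ge> 0" for z
  proof -
    have "P z = 7 / 24 * (z - 6 / 7 * \<rho>)\<^sup>2 + (1 - 3 / 14 * \<rho>\<^sup>2)"
      by (simp add: P_def power2_eq_square field_simps)
    moreover have "\<rho>\<^sup>2 \<le> 1" using rho_le_1 rho_pos by (intro power_le_one) auto
    ultimately show ?thesis by simp
  qed
  show ?thesis
  proof (cases "u \<le> 1")
    case False
    have "P u \<le> P v"
    proof -
      have "P v - P u = u\<^sup>2 * (7 / 24 * (2 * u + u\<^sup>2) - \<rho> / 2)"
        by (simp add: P_def v_def power2_eq_square field_simps)
      moreover have "7 / 24 * (2 * u + u\<^sup>2) \<ge> 7 / 24 * 2"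
        using False zero_le_power2[of u] unfolding distrib_left by linarith
      then have "u\<^sup>2 * (7 / 24 * (2 * u + u\<^sup>2) - \<rho> / 2) \<ge> 0"
        using rho_le_1 by (intro mult_nonneg_nonneg) auto
      ultimately show ?thesis by linarith
    qed
    also have "\<dots> \<le> exp (\<rho> * \<delta> u) * P v"
      using P_pos[of v] \<delta>_nonneg[of u] u by (simp add: mult_le_cancel_right1)
    finally show ?thesis by (simp add: P_def v_def)
  next
    case True
    have pw: "u ^ 6 \<le> u ^ 4" "u ^ 7 \<le> u ^ 4"
      using u True by (auto intro!: power_decreasing)
    have "P u \<le> (1 + \<rho> * (u\<^sup>2 / 2 - 2 / 3 * u ^ 3)) * P v"
    proof -
      have "(1 + \<rho> * (u\<^sup>2 / 2 - 2 / 3 * u ^ 3)) * P v - P u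
         = (7 / 12 - 2 / 3 * \<rho> - \<rho>\<^sup>2 / 4) * u ^ 3
           + (7 / 24 + 7 / 48 * \<rho> + \<rho>\<^sup>2 / 12) * u ^ 4
           + (\<rho>\<^sup>2 / 3 + 7 / 72 * \<rho>) * u ^ 5 - 35 / 144 * \<rho> * u ^ 6 - 7 / 36 * \<rho> * u ^ 7"
        by (simp add: P_def v_def power2_eq_square field_simps eval_nat_numeral)
      moreover have "7 / 12 - 2 / 3 * \<rho> - \<rho>\<^sup>2 / 4 \<ge> 0"
      proof -
        have "\<rho>\<^sup>2 \<le> (694 / 1000)\<^sup>2" using rho_bounds by (intro power_mono) auto
        then have "\<rho>\<^sup>2 / 4 \<le> 121 / 1000" by (simp add: power2_eq_square)
        then show ?thesis using rho_bounds(2) by linarith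
      qed
      then have "(7 / 12 - 2 / 3 * \<rho> - \<rho>\<^sup>2 / 4) * u ^ 3 \<ge> 0" using u by simp
      moreover have "(\<rho>\<^sup>2 / 3 + 7 / 72 * \<rho>) * u ^ 5 \<ge> 0" using u by simp
      moreover have "35 / 144 * \<rho> * u ^ 6 + 7 / 36 * \<rho> * u ^ 7 \<le> (7 / 24 + 7 / 48 * \<rho> + \<rho>\<^sup>2 / 12) * u ^ 4"
      proof -
        have "35 / 144 * \<rho> * u ^ 6 + 7 / 36 * \<rho> * u ^ 7 \<le> 35 / 144 * \<rho> * u ^ 4 + 7 / 36 * \<rho> * u ^ 4"
          using pw rho_pos by (intro add_mono mult_left_mono) auto
        also have "\<dots> = 63 / 144 * \<rho> * u ^ 4" by simp
        also have "\<dots> \<le> (7 / 24 + 7 / 48 * \<rho> + \<rho>\<^sup>2 / 12) * u ^ 4"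
        proof (rule mult_right_mono)
          have "0 \<le> \<rho>\<^sup>2 / 12" by simp
          then show "63 / 144 * \<rho> \<le> 7 / 24 + 7 / 48 * \<rho> + \<rho>\<^sup>2 / 12"
            using rho_le_1 by linarith
        qed (use u in simp)
        finally show ?thesis .
      qed
      ultimately show ?thesis by linarith
    qed
    also have "\<dots> \<le> exp (\<rho> * \<delta> u) * P v"
    proof (rule mult_right_mono[OF _ P_pos])
      have "1 + \<rho> * (u\<^sup>2 / 2 - 2 / 3 * u ^ 3) \<le> 1 + \<rho> * \<delta> u"
        using \<delta>_ge[of u] u by simp
      also have "\<dots> \<le> exp (\<rho> * \<delta> u)" by (rule exp_ge_add_one_self)
      finally show "1 + \<rho> * (u\<^sup>2 / 2 - 2 / 3 * u ^ 3) \<le> exp (\<rho> * \<delta> u)" .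
    qed
    finally show ?thesis by (simp add: P_def v_def)
  qed
qed
lemma growth_op_mono:
  assumes "\<And>k. k < n \<Longrightarrow> n \<le> 2 * k \<Longrightarrow> f k \<le> g k"
  shows "growth_op f n \<le> growth_op g n"
  unfolding growth_op_def
proof (rule sum_mono)
  fix k assume "k \<in> {..<n}"
  then show "real (k choose (n - k)) * f k \<le> real (k choose (n - k)) * g k"
    using assms[of k] by (cases "n \<le> 2 * k") (auto intro: mult_left_mono simp: binomial_eq_0)
qed

lemma growth_op_cmult: "growth_op (\<lambda>k. c * f k) n = c * growth_op f n"
  by (simp add: growth_op_def sum_distrib_left mult_ac)

lemma growth_op_diff: "growth_op (\<lambda>k. f k - g k) n = growth_op f n - growth_op g n"
  by (simp add: growth_op_def sum_subtractf right_diff_distrib)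

lemma growth_op_1: "n \<ge> 1 \<Longrightarrow> growth_op (\<lambda>k. 1) n \<ge> real n - 1"
proof -
  assume n: "n \<ge> 1"
  have "real ((n - 1) choose (n - (n - 1))) * 1 \<le> growth_op (\<lambda>k. 1) n"
    unfolding growth_op_def by (rule member_le_sum) (use n in auto)
  then show ?thesis using n by (simp add: of_nat_diff)
qed

lemma growth_op_tree_count: "n \<ge> 2 \<Longrightarrow> growth_op (\<lambda>k. real (tree_count k)) n = real (tree_count n)"
  by (simp add: growth_op_def tree_count_rec[of n])

text \<open>
  Only arguments in \<open>{n div 2..<n}\<close> matter for \<open>growth_op\<close> at \<open>n\<close>, hence an inequality on a window
  \<open>{N..<2 * N}\<close> suffices to start the induction.
\<close>

lemma growth_op_comparison:
  assumes rec: "\<And>n. n \<ge> 2 * N \<Longrightarrow> f n \<le> growth_op f n"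
    and supersolution: "\<And>n. n \<ge> 2 * N \<Longrightarrow> growth_op g n \<le> g n"
    and initial: "\<And>k. N \<le> k \<Longrightarrow> k < 2 * N \<Longrightarrow> f k \<le> g k"
    and "n \<ge> N"
  shows "f n \<le> g n"
  using \<open>n \<ge> N\<close>
proof (induction n rule: less_induct)
  case (less n)
  show ?case
  proof (cases "n < 2 * N")
    case False
    then have "f n \<le> growth_op f n" using rec by simp
    also have "\<dots> \<le> growth_op g n"
      using False less.IH by (intro growth_op_mono) auto
    also have "\<dots> \<le> g n" using False supersolution by simp
    finally show ?thesis .
  qed (use less.prems initial in auto)
qed

text \<open>
  Up to the constant factor \<open>\<rho> powr (- \<rho>)\<close> this is \<open>moment (\<rho> + j) n\<close>; the normalisation removes all
  non-integral powers of \<open>\<rho>\<close>.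
\<close>

definition model :: "nat \<Rightarrow> nat \<Rightarrow> real" where
  "model j n = Gamma (real n - \<rho> - real j) * \<rho> ^ j / \<rho> ^ n"

text \<open>
  The constant 1 absorbs the bounded error of \<open>growth_op_le\<close>: a constant function is multiplied by at least
  \<open>n - 1\<close> under \<open>growth_op\<close>, which is more than the error for \<open>n \<ge> 12\<close>.
\<close>

definition upper_model :: "nat \<Rightarrow> real" where
  "upper_model n = model 0 n - \<rho> / 2 * model 1 n - 1"

definition lower_model :: "nat \<Rightarrow> real" where
  "lower_model n = model 0 n - \<rho> / 2 * model 1 n + 7 / 24 * model 2 n + 1"

lemma model_eq_moment: "model j n = \<rho> powr (- \<rho>) * moment (\<rho> + real j) n"
proof -
  have "\<rho> powr (- \<rho>) / \<rho> powr (real n - (\<rho> + real j)) = \<rho> powr (real j - real n)"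
    by (simp add: powr_diff[symmetric] algebra_simps)
  also have "\<dots> = \<rho> ^ j / \<rho> ^ n"
    by (simp add: powr_diff powr_realpow)
  finally have e: "\<rho> powr (- \<rho>) / \<rho> powr (real n - (\<rho> + real j)) = \<rho> ^ j / \<rho> ^ n" .
  have "\<rho> powr (- \<rho>) * moment (\<rho> + real j) n
      = Gamma (real n - (\<rho> + real j)) * (\<rho> powr (- \<rho>) / \<rho> powr (real n - (\<rho> + real j)))"
    by (simp only: moment_def times_divide_eq_right mult.commute)
  then show ?thesis
    unfolding e by (simp add: model_def diff_diff_eq)
qed

lemma rho_powr_le: "\<rho> powr (- \<rho>) \<le> 2"
proof -
  have "\<rho> powr (- \<rho>) \<le> (1 / 2) powr (- \<rho>)"
    using rho_bounds by (intro powr_mono2') auto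
  also have "\<dots> = 2 powr \<rho>"
    by (simp add: powr_divide powr_minus_divide)
  also have "\<dots> \<le> 2 powr 1"
    using rho_le_1 by (intro powr_mono) auto
  finally show ?thesis by simp
qed

text \<open>
  A bound for the additive constant of \<open>growth_op_le\<close> with the coefficients of either model.
\<close>

lemma error_const_le: "2 / \<rho> * (\<rho> powr (- \<rho>) * (1 + \<rho> / 2 + 7 / 24)) \<le> 10"
proof -
  have "2 / \<rho> \<le> 3"
    using rho_bounds by (simp add: divide_le_eq)
  moreover have "1 + \<rho> / 2 + 7 / 24 \<le> 5 / 3"
    using rho_bounds by simp
  ultimately have "2 / \<rho> * (\<rho> powr (- \<rho>) * (1 + \<rho> / 2 + 7 / 24)) \<le> 3 * (2 * (5 / 3))"
    using rho_powr_le by (intro mult_mono) auto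
  then show ?thesis by simp
qed

lemma growth_op_upper_model:
  assumes "n \<ge> 12"
  shows "growth_op upper_model n \<le> upper_model n"
proof -
  define A where "A = \<rho> powr (- \<rho>)"
  define c :: "nat \<Rightarrow> real" where "c = (\<lambda>j. if j = 0 then A else - (A * (\<rho> / 2)))"
  define g where "g = (\<lambda>k. \<Sum>j<2. c j * moment (\<rho> + real j) k)"
  have A: "A > 0" by (simp add: A_def)
  have upper_model: "upper_model k = g k - 1" for k
    by (simp add: upper_model_def g_def c_def A_def model_eq_moment numeral_2_eq_2)
  have "growth_op g n \<le> g n + 2 / \<rho> * (\<Sum>j<2. \<bar>c j\<bar>)"
    unfolding g_def
  proof (rule growth_op_le)
    fix x :: real assume x: "x > 0"
    define a where "a = exp (- \<rho> * x) * x powr (- \<rho>)"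
    define u where "u = 1 / x"
    have "a > 0" "u > 0" using x by (simp_all add: a_def u_def)
    have "(\<Sum>j<2. c j * kernel (\<rho> + real j) (\<tau> x))
        = 2 * (A * a) * (exp (\<rho> * \<delta> u) * (1 - \<rho> / 2 * (u + u\<^sup>2)))"
      unfolding kernel_tau(2)[OF x] a_def[symmetric] u_def[symmetric]
      by (simp add: c_def numeral_2_eq_2 algebra_simps)
    also have "\<dots> \<le> 2 * (A * a) * (1 - \<rho> / 2 * u)"
      using A \<open>a > 0\<close> upper_pointwise[OF \<open>u > 0\<close>] by (intro mult_left_mono) auto
    also have "\<dots> = 2 * (\<Sum>j<2. c j * kernel (\<rho> + real j) x)"
      unfolding kernel_tau(1)[OF x] a_def[symmetric] u_def[symmetric]
      by (simp add: c_def numeral_2_eq_2 algebra_simps)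
    finally show "(\<Sum>j<2. c j * kernel (\<rho> + real j) (\<tau> x)) \<le> 2 * (\<Sum>j<2. c j * kernel (\<rho> + real j) x)" .
  qed (use assms in simp)
  also have "2 / \<rho> * (\<Sum>j<2. \<bar>c j\<bar>) \<le> 10"
  proof -
    have "(\<Sum>j<2. \<bar>c j\<bar>) \<le> A * (1 + \<rho> / 2 + 7 / 24)"
      using A by (simp add: c_def numeral_2_eq_2 algebra_simps abs_mult)
    then have "2 / \<rho> * (\<Sum>j<2. \<bar>c j\<bar>) \<le> 2 / \<rho> * (A * (1 + \<rho> / 2 + 7 / 24))"
      by (intro mult_left_mono) auto
    then show ?thesis using error_const_le unfolding A_def by linarith
  qed
  moreover have "growth_op upper_model n = growth_op g n - growth_op (\<lambda>k. 1) n"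
    unfolding growth_op_diff[symmetric] upper_model ..
  moreover have "growth_op (\<lambda>k. 1) n \<ge> 11"
    using growth_op_1[of n] assms by simp
  ultimately show ?thesis unfolding upper_model by linarith
qed

lemma growth_op_lower_model:
  assumes "n \<ge> 12"
  shows "lower_model n \<le> growth_op lower_model n"
proof -
  define A where "A = \<rho> powr (- \<rho>)"
  define c :: "nat \<Rightarrow> real" where
    "c = (\<lambda>j. if j = 0 then - A else if j = 1 then A * (\<rho> / 2) else - (A * (7 / 24)))"
  define g where "g = (\<lambda>k. \<Sum>j<3. c j * moment (\<rho> + real j) k)"
  have A: "A > 0" by (simp add: A_def)
  have lower_model: "lower_model k = 1 - g k" for k
    by (simp add: lower_model_def g_def c_def A_def model_eq_moment numeral_3_eq_3 mult_ac)
  have "growth_op g n \<le> g n + 2 / \<rho> * (\<Sum>j<3. \<bar>c j\<bar>)"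
    unfolding g_def
  proof (rule growth_op_le)
    fix x :: real assume x: "x > 0"
    define a where "a = exp (- \<rho> * x) * x powr (- \<rho>)"
    define u where "u = 1 / x"
    have "a > 0" "u > 0" using x by (simp_all add: a_def u_def)
    have "(\<Sum>j<3. c j * kernel (\<rho> + real j) (\<tau> x))
        = - (2 * (A * a) * (exp (\<rho> * \<delta> u) * (1 - \<rho> / 2 * (u + u\<^sup>2) + 7 / 24 * (u + u\<^sup>2)\<^sup>2)))"
      unfolding kernel_tau(2)[OF x] a_def[symmetric] u_def[symmetric]
      by (simp add: c_def numeral_3_eq_3 power2_eq_square algebra_simps)
    also have "\<dots> \<le> - (2 * (A * a) * (1 - \<rho> / 2 * u + 7 / 24 * u\<^sup>2))"
      using A \<open>a > 0\<close> lower_pointwise[OF \<open>u > 0\<close>] by (intro le_imp_neg_le mult_left_mono) auto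
    also have "\<dots> = 2 * (\<Sum>j<3. c j * kernel (\<rho> + real j) x)"
      unfolding kernel_tau(1)[OF x] a_def[symmetric] u_def[symmetric]
      by (simp add: c_def numeral_3_eq_3 power2_eq_square algebra_simps)
    finally show "(\<Sum>j<3. c j * kernel (\<rho> + real j) (\<tau> x)) \<le> 2 * (\<Sum>j<3. c j * kernel (\<rho> + real j) x)" .
  qed (use assms in simp)
  also have "2 / \<rho> * (\<Sum>j<3. \<bar>c j\<bar>) \<le> 10"
  proof -
    have "(\<Sum>j<3. \<bar>c j\<bar>) = A * (1 + \<rho> / 2 + 7 / 24)"
      using A by (simp add: c_def numeral_3_eq_3 algebra_simps abs_mult)
    then show ?thesis using error_const_le unfolding A_def by simp
  qed
  moreover have "growth_op lower_model n = growth_op (\<lambda>k. 1) n - growth_op g n"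
    unfolding growth_op_diff[symmetric] lower_model ..
  moreover have "growth_op (\<lambda>k. 1) n \<ge> 11"
    using growth_op_1[of n] assms by simp
  ultimately show ?thesis unfolding lower_model by linarith
qed

lemma model_pos: "n \<ge> j + 1 \<Longrightarrow> model j n > 0"
  using rho_le_1 by (auto simp: model_def intro!: divide_pos_pos mult_pos_pos Gamma_real_pos)

lemma model_Suc_index:
  assumes "n \<ge> j + 2"
  shows "model (Suc j) n = model j n * (\<rho> / (real n - real j - 1 - \<rho>))"
proof -
  define z where "z = real n - real j - 1 - \<rho>"
  have z: "z > 0" using assms rho_le_1 by (simp add: z_def)
  have g: "Gamma (z + 1) = z * Gamma z"
    using z by (intro Gamma_plus1) auto
  have e: "real n - \<rho> - real j = z + 1" "real n - \<rho> - real (Suc j) = z"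
    by (simp_all add: z_def)
  show ?thesis
    unfolding model_def e g z_def[symmetric] using z by (simp add: mult_ac)
qed

lemma model_Suc:
  assumes "n \<ge> j + 1"
  shows "model j (Suc n) = model j n * ((real n - real j - \<rho>) / \<rho>)"
proof -
  define z where "z = real n - real j - \<rho>"
  have z: "z > 0" using assms rho_le_1 by (simp add: z_def)
  have g: "Gamma (z + 1) = z * Gamma z"
    using z by (intro Gamma_plus1) auto
  have e: "real (Suc n) - \<rho> - real j = z + 1" "real n - \<rho> - real j = z"
    by (simp_all add: z_def)
  show ?thesis
    unfolding model_def e g z_def[symmetric] using z by (simp add: mult_ac)
qed

lemma upper_model_eq: "n \<ge> 2 \<Longrightarrow> upper_model n = model 0 n * (1 - \<rho>\<^sup>2 / (2 * (real n - 1 - \<rho>))) - 1"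
  using model_Suc_index[of 0 n] by (simp add: upper_model_def power2_eq_square algebra_simps)

lemma lower_model_eq:
  assumes "n \<ge> 3"
  shows "lower_model n = model 0 n * (1 - \<rho>\<^sup>2 / (2 * (real n - 1 - \<rho>))
      + 7 / 24 * \<rho>\<^sup>2 / ((real n - 1 - \<rho>) * (real n - 2 - \<rho>))) + 1"
proof -
  have "model 2 n = model 0 n * (\<rho> / (real n - 1 - \<rho>)) * (\<rho> / (real n - 2 - \<rho>))"
    using model_Suc_index[of 0 n] model_Suc_index[of 1 n] assms by (simp add: numeral_2_eq_2 algebra_simps)
  then show ?thesis using model_Suc_index[of 0 n] assms
    by (simp add: lower_model_def power2_eq_square algebra_simps)
qed

section \<open>Convergence of the quotient by the model\<close>

lemma sum_shift_le:
  fixes D :: "nat \<Rightarrow> real"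
  assumes "\<And>n. D n \<ge> 0" "D 0 = 0"
  shows "(\<Sum>n\<le>X. D (n - m)) \<le> (\<Sum>n\<le>X. D n)"
proof (induction m)
  case (Suc m)
  have "(\<Sum>n\<le>X. D (n - Suc m)) \<le> (\<Sum>n\<le>X. D (n - m))"
  proof (cases X)
    case (Suc Y)
    have "(\<Sum>n\<le>X. D (n - Suc m)) = D 0 + (\<Sum>n\<le>Y. D (n - m))"
      unfolding Suc by (subst sum.atMost_Suc_shift) simp
    also have "\<dots> \<le> (\<Sum>n\<le>X. D (n - m))"
      using assms unfolding Suc by simp
    finally show ?thesis .
  qed (use assms in simp)
  then show ?case using Suc by linarith
qed simp

lemma convergent_if_summable_diffs:
  fixes r :: "nat \<Rightarrow> real"
  assumes "summable (\<lambda>n. r (Suc n) - r n)"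
  shows "convergent r"
proof -
  have "convergent (\<lambda>n. (\<Sum>i<n. r (Suc i) - r i) + r 0)"
    using assms by (intro convergent_add convergent_const) (simp add: summable_iff_convergent)
  then show ?thesis by (simp add: sum_lessThan_telescope)
qed

text \<open>
  Write \<open>r = f / g\<close> and \<open>D n = \<bar>r n - r (n - 1)\<bar>\<close>.  The recurrence expresses \<open>r n\<close> through the
  earlier \<open>r k\<close> with nonnegative weights that add up to \<open>1 - O(1 / n\<^sup>2)\<close>.  Subtracting \<open>r (n - 1)\<close> and
  telescoping \<open>r k - r (n - 1)\<close> bounds \<open>D n\<close> by a sum of earlier differences plus \<open>O(1 / n\<^sup>2)\<close>.
  Summed over \<open>n\<close>, a difference is counted with total weight at most \<open>\<Sum>l. q l * (l - 1) \<le> \<theta> < 1\<close>, so the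
  partial sums of \<open>D\<close> are bounded.  The term \<open>k = n - 1\<close> contributes
  the difference 0, which is why \<open>q\<close> bounds the weights from distance 2 on.
\<close>

lemma ratio_convergent:
  fixes f g q :: "nat \<Rightarrow> real"
  assumes N: "N \<ge> 1"
    and f: "\<And>n. n \<ge> 2 * N \<Longrightarrow> growth_op f n = f n"
    and g_pos: "\<And>n. n \<ge> N \<Longrightarrow> g n > 0"
    and bd: "\<And>n. n \<ge> N \<Longrightarrow> \<bar>f n\<bar> \<le> \<beta> * g n"
    and defect: "\<And>n. n \<ge> 2 * N \<Longrightarrow> \<bar>g n - growth_op g n\<bar> \<le> C / real n ^ 2 * g n"
    and q: "\<And>n k. n \<ge> 2 * N \<Longrightarrow> k + 2 \<le> n \<Longrightarrow> n \<le> 2 * k \<Longrightarrow>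
               real (k choose (n - k)) * g k \<le> q (n - k) * g n"
    and q_nonneg: "\<And>l. q l \<ge> 0"
    and q_sum: "\<And>X. (\<Sum>l\<le>X. q l * real (l - 1)) \<le> \<theta>"
    and "\<theta> < 1"
  shows "convergent (\<lambda>n. f n / g n)"
proof -
  define r where "r = (\<lambda>n. f n / g n)"
  define D where "D = (\<lambda>n. if n > N then \<bar>r n - r (n - 1)\<bar> else 0)"
  have D_nonneg: "D n \<ge> 0" and D_0: "D 0 = 0" for n by (simp_all add: D_def)
  have r_bd: "\<bar>r n\<bar> \<le> \<beta>" if "n \<ge> N" for n
    using bd[OF that] g_pos[OF that] by (simp add: r_def abs_divide divide_le_eq)
  have \<beta>: "\<beta> \<ge> 0" using r_bd[of N] by simp
  have C: "C \<ge> 0"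
  proof -
    have "0 \<le> C / real (2 * N) ^ 2 * g (2 * N)"
      using defect[of "2 * N"] by linarith
    then show ?thesis using N g_pos[of "2 * N"] by (simp add: zero_le_mult_iff zero_le_divide_iff)
  qed
  have r_diff: "\<bar>r k - r n\<bar> \<le> (\<Sum>m\<in>{k<..n}. D m)" if "N \<le> k" "k \<le> n" for k n
    using that(2,1)
  proof (induction n rule: dec_induct)
    case (step n)
    have "{k<..Suc n} = insert (Suc n) {k<..n}" using step by auto
    moreover have "D (Suc n) = \<bar>r (Suc n) - r n\<bar>" using step by (simp add: D_def)
    ultimately show ?case using step by simp
  qed simp
  have D_rec: "D n \<le> (\<Sum>l\<le>n. q l * (\<Sum>m\<in>{1..<l}. D (n - m))) + C * \<beta> * (1 / real n ^ 2)"
    if n: "n \<ge> 2 * N" for n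
  proof -
    have n1: "n > N" "n - 1 \<ge> N" "n \<ge> N" using n N by linarith+
    define w where "w = (\<lambda>k. real (k choose (n - k)) * g k / g n)"
    have gn: "g n > 0" using g_pos n1 by simp
    have w_eq: "w k * r k = real (k choose (n - k)) * f k / g n" if "k < n" for k
    proof (cases "n \<le> 2 * k")
      case True
      then have "g k > 0" using g_pos[of k] n by simp
      then show ?thesis by (simp add: w_def r_def)
    next
      case False
      then show ?thesis by (simp add: w_def binomial_eq_0)
    qed
    have "r n = growth_op f n / g n" using f[OF n] by (simp add: r_def)
    also have "\<dots> = (\<Sum>k<n. w k * r k)"
      unfolding growth_op_def sum_divide_distrib using w_eq by (intro sum.cong) auto
    finally have rn: "r n = (\<Sum>k<n. w k * r k)" .
    have sw: "(\<Sum>k<n. w k) = growth_op g n / g n"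
      by (simp add: w_def growth_op_def sum_divide_distrib)
    have "r n - r (n - 1) = (\<Sum>k<n. w k * (r k - r (n - 1))) - (1 - (\<Sum>k<n. w k)) * r (n - 1)"
      by (simp add: rn right_diff_distrib left_diff_distrib sum_subtractf sum_distrib_right)
    then have "\<bar>r n - r (n - 1)\<bar> \<le> \<bar>\<Sum>k<n. w k * (r k - r (n - 1))\<bar> + \<bar>1 - (\<Sum>k<n. w k)\<bar> * \<bar>r (n - 1)\<bar>"
      by (metis abs_mult abs_triangle_ineq4)
    also have "\<bar>\<Sum>k<n. w k * (r k - r (n - 1))\<bar> \<le> (\<Sum>k<n. \<bar>w k * (r k - r (n - 1))\<bar>)"
      by (rule sum_abs)
    also have "\<dots> \<le> (\<Sum>k<n. q (n - k) * (\<Sum>m\<in>{1..<n - k}. D (n - m)))"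
    proof (rule sum_mono)
      fix k assume k: "k \<in> {..<n}"
      have nn: "(\<Sum>m\<in>{1..<n - k}. D (n - m)) \<ge> 0" by (intro sum_nonneg D_nonneg)
      consider "n > 2 * k" | "k = n - 1" | "n \<le> 2 * k" "k + 2 \<le> n" using k by fastforce
      then show "\<bar>w k * (r k - r (n - 1))\<bar> \<le> q (n - k) * (\<Sum>m\<in>{1..<n - k}. D (n - m))"
      proof cases
        case 1
        then show ?thesis using nn q_nonneg by (simp add: w_def binomial_eq_0)
      next
        case 2
        then show ?thesis using nn q_nonneg by simp
      next
        case 3
        then have kN: "k \<ge> N" using n by simp
        have w: "0 \<le> w k" "w k \<le> q (n - k)"
          using q[OF n] 3 gn g_pos[OF kN] by (simp_all add: w_def divide_le_eq)
        have "\<bar>r k - r (n - 1)\<bar> \<le> (\<Sum>m\<in>{k<..n - 1}. D m)"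
          using r_diff[of k "n - 1"] kN 3 by simp
        also have "\<dots> = (\<Sum>m\<in>{1..<n - k}. D (n - m))"
          by (rule sum.reindex_bij_witness[of _ "\<lambda>m. n - m" "\<lambda>m. n - m"]) (use 3 in auto)
        finally have "\<bar>r k - r (n - 1)\<bar> \<le> (\<Sum>m\<in>{1..<n - k}. D (n - m))" .
        then show ?thesis using w by (simp add: abs_mult mult_mono)
      qed
    qed
    also have "\<dots> = (\<Sum>l\<in>{1..n}. q l * (\<Sum>m\<in>{1..<l}. D (n - m)))"
      by (rule sum.reindex_bij_witness[of _ "\<lambda>l. n - l" "\<lambda>k. n - k"]) auto
    also have "\<dots> \<le> (\<Sum>l\<le>n. q l * (\<Sum>m\<in>{1..<l}. D (n - m)))"
      by (intro sum_mono2) (auto intro!: mult_nonneg_nonneg sum_nonneg q_nonneg D_nonneg)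
    also have "\<bar>1 - (\<Sum>k<n. w k)\<bar> * \<bar>r (n - 1)\<bar> \<le> C / real n ^ 2 * \<beta>"
    proof (rule mult_mono)
      have "\<bar>1 - (\<Sum>k<n. w k)\<bar> = \<bar>g n - growth_op g n\<bar> / g n"
        using gn by (simp add: sw diff_divide_distrib[symmetric] abs_divide field_simps)
      also have "\<dots> \<le> C / real n ^ 2"
        using defect[OF n] gn by (simp add: divide_le_eq)
      finally show "\<bar>1 - (\<Sum>k<n. w k)\<bar> \<le> C / real n ^ 2" .
    qed (use r_bd n1 C in auto)
    finally show ?thesis using n1 by (simp add: D_def mult_ac)
  qed
  \<comment> \<open>\<open>K\<close> collects the differences before the recurrence applies and all defects\<close>
  define K where "K = (\<Sum>n<2 * N. D n) + C * \<beta> * (\<Sum>n. 1 / real n ^ 2)"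
  have "summable (\<lambda>n. 1 / real n ^ 2)"
    using inverse_power_summable[of 2, where 'a = real] by (simp add: divide_inverse)
  have S_bd: "(\<Sum>n\<le>X. D n) \<le> K / (1 - \<theta>)" for X
  proof -
    have "(\<Sum>n\<le>X. D n) \<le> (\<Sum>n\<le>X. (if n < 2 * N then D n else 0) +
        ((\<Sum>l\<le>X. q l * (\<Sum>m\<in>{1..<l}. D (n - m))) + C * \<beta> * (1 / real n ^ 2)))"
    proof (rule sum_mono)
      fix n assume n: "n \<in> {..X}"
      have nn: "q l * (\<Sum>m\<in>{1..<l}. D (n - m)) \<ge> 0" for l
        by (intro mult_nonneg_nonneg sum_nonneg q_nonneg D_nonneg)
      have "(\<Sum>l\<le>n. q l * (\<Sum>m\<in>{1..<l}. D (n - m))) \<le> (\<Sum>l\<le>X. q l * (\<Sum>m\<in>{1..<l}. D (n - m)))"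
        using n nn by (intro sum_mono2) auto
      moreover have "C * \<beta> * (1 / real n ^ 2) \<ge> 0" using C \<beta> by simp
      moreover have "(\<Sum>l\<le>n. q l * (\<Sum>m\<in>{1..<l}. D (n - m))) \<ge> 0" using nn by (intro sum_nonneg) auto
      ultimately show "D n \<le> (if n < 2 * N then D n else 0) +
        ((\<Sum>l\<le>X. q l * (\<Sum>m\<in>{1..<l}. D (n - m))) + C * \<beta> * (1 / real n ^ 2))"
        using D_rec[of n] by (cases "n < 2 * N") auto
    qed
    also have "\<dots> = (\<Sum>n\<le>X. if n < 2 * N then D n else 0)
        + (\<Sum>n\<le>X. \<Sum>l\<le>X. q l * (\<Sum>m\<in>{1..<l}. D (n - m))) + C * \<beta> * (\<Sum>n\<le>X. 1 / real n ^ 2)"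
      by (simp add: sum.distrib sum_distrib_left)
    also have "(\<Sum>n\<le>X. if n < 2 * N then D n else 0) \<le> (\<Sum>n<2 * N. D n)"
    proof -
      have "(\<Sum>n\<le>X. if n < 2 * N then D n else 0) = (\<Sum>n\<in>{..X} \<inter> {..<2 * N}. D n)"
        by (simp add: sum.inter_restrict)
      also have "\<dots> \<le> (\<Sum>n<2 * N. D n)"
        by (intro sum_mono2) (auto intro: D_nonneg)
      finally show ?thesis .
    qed
    also have "(\<Sum>n\<le>X. \<Sum>l\<le>X. q l * (\<Sum>m\<in>{1..<l}. D (n - m))) \<le> \<theta> * (\<Sum>n\<le>X. D n)"
    proof -
      have "(\<Sum>n\<le>X. \<Sum>l\<le>X. q l * (\<Sum>m\<in>{1..<l}. D (n - m)))
          = (\<Sum>l\<le>X. q l * (\<Sum>m\<in>{1..<l}. \<Sum>n\<le>X. D (n - m)))"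
      proof (subst sum.swap, intro sum.cong refl)
        fix l
        have "(\<Sum>n\<le>X. q l * (\<Sum>m\<in>{1..<l}. D (n - m))) = q l * (\<Sum>n\<le>X. \<Sum>m\<in>{1..<l}. D (n - m))"
          by (simp only: sum_distrib_left)
        also have "(\<Sum>n\<le>X. \<Sum>m\<in>{1..<l}. D (n - m)) = (\<Sum>m\<in>{1..<l}. \<Sum>n\<le>X. D (n - m))"
          by (rule sum.swap)
        finally show "(\<Sum>n\<le>X. q l * (\<Sum>m\<in>{1..<l}. D (n - m))) = q l * (\<Sum>m\<in>{1..<l}. \<Sum>n\<le>X. D (n - m))" .
      qed
      also have "\<dots> \<le> (\<Sum>l\<le>X. q l * (\<Sum>m\<in>{1..<l}. \<Sum>n\<le>X. D n))"
        by (intro sum_mono mult_left_mono sum_shift_le D_nonneg D_0 q_nonneg)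
      also have "\<dots> = (\<Sum>l\<le>X. q l * real (l - 1)) * (\<Sum>n\<le>X. D n)"
        unfolding sum_distrib_right by (intro sum.cong refl) simp
      also have "\<dots> \<le> \<theta> * (\<Sum>n\<le>X. D n)"
        by (intro mult_right_mono q_sum sum_nonneg D_nonneg)
      finally show ?thesis .
    qed
    also have "C * \<beta> * (\<Sum>n\<le>X. 1 / real n ^ 2) \<le> C * \<beta> * (\<Sum>n. 1 / real n ^ 2)"
      using C \<beta> \<open>summable (\<lambda>n. 1 / real n ^ 2)\<close>
      by (intro mult_left_mono sum_le_suminf) auto
    finally have "(\<Sum>n\<le>X. D n) \<le> K + \<theta> * (\<Sum>n\<le>X. D n)"
      by (simp add: K_def)
    then show ?thesis using \<open>\<theta> < 1\<close> by (simp add: field_simps)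
  qed
  have "summable D"
  proof (rule summableI_nonneg_bounded)
    show "(\<Sum>i<n. D i) \<le> K / (1 - \<theta>)" for n
      using S_bd[of n] D_nonneg[of n] by (simp add: lessThan_Suc_atMost[symmetric])
  qed (rule D_nonneg)
  then have "summable (\<lambda>n. D (n + Suc N))" by (subst summable_iff_shift)
  then have "summable (\<lambda>n. \<bar>r (Suc n + N) - r (n + N)\<bar>)" by (simp add: D_def)
  then have "convergent (\<lambda>n. r (n + N))"
    by (intro convergent_if_summable_diffs) (rule summable_rabs_cancel)
  then have "convergent r" by (simp only: convergent_ignore_initial_segment)
  then show ?thesis by (simp only: r_def)
qed
lemma model_ge_square: "\<exists>c>0. \<forall>n\<ge>4. model 0 n \<ge> c * real n ^ 2"
proof (intro exI conjI allI impI)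
  show "model 0 4 / 16 > 0" using model_pos[of 0 4] by simp
  fix n :: nat assume "4 \<le> n"
  then show "model 0 n \<ge> model 0 4 / 16 * real n ^ 2"
  proof (induction n rule: dec_induct)
    case (step n)
    have 1: "(real n - \<rho>) / \<rho> \<ge> 2"
      using step rho_le_1 by (simp add: le_divide_eq)
    have "real (Suc n) ^ 2 \<le> 2 * real n ^ 2"
    proof -
      have "real n * real n \<ge> 4 * real n" using step by (intro mult_right_mono) auto
      moreover have "real (Suc n) ^ 2 = real n * real n + 2 * real n + 1"
        by (simp add: power2_eq_square algebra_simps)
      moreover have "real n \<ge> 4" using step by simp
      ultimately show ?thesis unfolding power2_eq_square[of "real n"] by linarith
    qed
    then have "model 0 4 / 16 * real (Suc n) ^ 2 \<le> model 0 4 / 16 * real n ^ 2 * 2"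
      using model_pos[of 0 4] by (simp add: mult.assoc mult_left_mono)
    also have "\<dots> \<le> model 0 n * ((real n - \<rho>) / \<rho>)"
      using step model_pos[of 0 4] model_pos[of 0 n] 1 by (intro mult_mono) auto
    also have "\<dots> = model 0 (Suc n)"
      using model_Suc[of 0 n] step by simp
    finally show ?case .
  qed simp
qed

lemma inverse_model_tendsto: "(\<lambda>n. 1 / model 0 n) \<longlonglongrightarrow> 0"
proof -
  obtain c where c: "c > 0" "\<And>n. n \<ge> 4 \<Longrightarrow> model 0 n \<ge> c * real n ^ 2"
    using model_ge_square by blast
  show ?thesis
  proof (rule tendsto_sandwich[of "\<lambda>_. 0" _ _ "\<lambda>n. 1 / (c * real n ^ 2)"])
    show "\<forall>\<^sub>F n in sequentially. 0 \<le> 1 / model 0 n"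
      using eventually_ge_at_top[of 1] by eventually_elim (use model_pos[of 0] in \<open>auto simp: less_imp_le\<close>)
    show "\<forall>\<^sub>F n in sequentially. 1 / model 0 n \<le> 1 / (c * real n ^ 2)"
      using eventually_ge_at_top[of 4]
    proof eventually_elim
      case (elim n)
      then show ?case using c by (intro divide_left_mono) (auto intro!: mult_pos_pos model_pos)
    qed
    show "(\<lambda>n. 1 / (c * real n ^ 2)) \<longlonglongrightarrow> 0"
      using c(1) by real_asymp
  qed simp
qed

lemma upper_model_tendsto: "(\<lambda>n. upper_model n / model 0 n) \<longlonglongrightarrow> 1"
proof -
  have "(\<lambda>n. (1 - \<rho>\<^sup>2 / (2 * (real n - 1 - \<rho>))) - 1 / model 0 n) \<longlonglongrightarrow> 1 - 0"
  proof (intro tendsto_diff inverse_model_tendsto)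
    show "(\<lambda>n. 1 - \<rho>\<^sup>2 / (2 * (real n - 1 - \<rho>))) \<longlonglongrightarrow> 1" by real_asymp
  qed
  moreover have "\<forall>\<^sub>F n in sequentially. (1 - \<rho>\<^sup>2 / (2 * (real n - 1 - \<rho>))) - 1 / model 0 n = upper_model n / model 0 n"
    using eventually_ge_at_top[of 2]
  proof eventually_elim
    case (elim n)
    then show ?case using model_pos[of 0 n] by (simp add: upper_model_eq diff_divide_distrib)
  qed
  ultimately show ?thesis by (simp add: filterlim_cong)
qed

lemma lower_model_tendsto: "(\<lambda>n. lower_model n / model 0 n) \<longlonglongrightarrow> 1"
proof -
  have "(\<lambda>n. (1 - \<rho>\<^sup>2 / (2 * (real n - 1 - \<rho>))
      + 7 / 24 * \<rho>\<^sup>2 / ((real n - 1 - \<rho>) * (real n - 2 - \<rho>))) + 1 / model 0 n) \<longlonglongrightarrow> 1 + 0"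
  proof (intro tendsto_add inverse_model_tendsto)
    show "(\<lambda>n. 1 - \<rho>\<^sup>2 / (2 * (real n - 1 - \<rho>))
      + 7 / 24 * \<rho>\<^sup>2 / ((real n - 1 - \<rho>) * (real n - 2 - \<rho>))) \<longlonglongrightarrow> 1" by real_asymp
  qed
  moreover have "\<forall>\<^sub>F n in sequentially. (1 - \<rho>\<^sup>2 / (2 * (real n - 1 - \<rho>))
      + 7 / 24 * \<rho>\<^sup>2 / ((real n - 1 - \<rho>) * (real n - 2 - \<rho>))) + 1 / model 0 n = lower_model n / model 0 n"
    using eventually_ge_at_top[of 3]
  proof eventually_elim
    case (elim n)
    then show ?case using model_pos[of 0 n] by (simp add: lower_model_eq add_divide_distrib)
  qed
  ultimately show ?thesis by (simp add: filterlim_cong)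
qed

text \<open>
  After cancelling, the claim compares \<open>pochhammer (k - l + 1) l\<close> with \<open>pochhammer (k - \<rho>) l\<close>, where
  \<open>l = n - k\<close>.  This holds factor by factor once \<open>l \<ge> 1 + \<rho>\<close>, hence for \<open>l \<ge> 2\<close>.
\<close>

lemma model_ratio_bound:
  assumes "k + 2 \<le> n" "n \<le> 2 * k"
  shows "real (k choose (n - k)) * model 0 k \<le> \<rho> ^ (n - k) / fact (n - k) * model 0 n"
proof -
  define l where "l = n - k"
  have l: "l \<ge> 2" "l \<le> k" "n = k + l" using assms by (auto simp: l_def)
  have k: "real k - \<rho> > 0" using l rho_le_1 by simp
  have "real (k choose l) * fact l = pochhammer (real k - real l + 1) l"
    by (simp add: binomial_gbinomial gbinomial_pochhammer')
  also have "\<dots> \<le> pochhammer (real k - \<rho>) l"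
    unfolding pochhammer_prod using l rho_le_1 by (intro prod_mono) auto
  also have "\<dots> = Gamma (real k - \<rho> + real l) / Gamma (real k - \<rho>)"
    using k by (intro pochhammer_Gamma) (auto elim!: nonpos_Ints_cases)
  finally have "real (k choose l) * fact l * Gamma (real k - \<rho>) \<le> Gamma (real n - \<rho>)"
    using k l(3) by (simp add: le_divide_eq algebra_simps)
  then have "real (k choose l) * Gamma (real k - \<rho>) \<le> Gamma (real n - \<rho>) / fact l"
    by (simp add: le_divide_eq mult_ac)
  then have "real (k choose l) * Gamma (real k - \<rho>) / \<rho> ^ k \<le> Gamma (real n - \<rho>) / fact l / \<rho> ^ k"
    by (intro divide_right_mono) auto
  also have "\<dots> = \<rho> ^ l / fact l * (Gamma (real n - \<rho>) / \<rho> ^ n)"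
    using l(3) by (simp add: power_add)
  finally show ?thesis by (simp add: model_def l_def)
qed

text \<open>
  The full series of \<open>(l - 1) * \<rho> ^ l / fact l\<close> over \<open>l \<ge> 1\<close> is
  \<open>\<rho> * exp \<rho> - (exp \<rho> - 1) = 2 * \<rho> - 1\<close>.  The factor 2 makes room for bounding \<open>model 0 n\<close> by
  \<open>2 * upper_model n\<close>; twice the sum is still less than 1.
\<close>

lemma weights_sum_le: "(\<Sum>l\<le>X. 2 * (\<rho> ^ l / fact l) * real (l - 1)) \<le> 2 * (2 * \<rho> - 1)"
proof -
  have e: "(\<lambda>l. \<rho> ^ l / fact l) sums 2"
    using exp_converges[of \<rho>] exp_rho by (simp add: scaleR_conv_of_real field_simps)
  have "(\<lambda>l. \<rho> ^ Suc l / fact (Suc l) * real (Suc l)) sums (\<rho> * 2)"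
  proof -
    have "\<rho> ^ Suc l / fact (Suc l) * real (Suc l) = \<rho> * (\<rho> ^ l / fact l)" for l
      by (simp add: fact_Suc field_simps del: of_nat_Suc)
    then show ?thesis using sums_mult[OF e, of \<rho>] by simp
  qed
  moreover have "(\<lambda>l. \<rho> ^ Suc l / fact (Suc l)) sums (2 - 1)"
    using e by (subst sums_Suc_iff) simp
  ultimately have "(\<lambda>l. \<rho> ^ Suc l / fact (Suc l) * real (Suc l) - \<rho> ^ Suc l / fact (Suc l)) sums (\<rho> * 2 - (2 - 1))"
    by (rule sums_diff)
  then have "(\<lambda>l. 2 * (\<rho> ^ Suc l / fact (Suc l) * real (Suc l) - \<rho> ^ Suc l / fact (Suc l)))
      sums (2 * (\<rho> * 2 - (2 - 1)))"
    by (rule sums_mult)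
  moreover have "2 * (a * real (Suc l) - a) = 2 * a * real (Suc l - 1)" for a l
    by (simp add: algebra_simps)
  ultimately have s: "(\<lambda>l. 2 * (\<rho> ^ Suc l / fact (Suc l)) * real (Suc l - 1)) sums (2 * (2 * \<rho> - 1))"
    by (simp only: mult.commute[of \<rho> 2]) simp
  have "(\<Sum>l\<le>X. 2 * (\<rho> ^ l / fact l) * real (l - 1)) = (\<Sum>l<X. 2 * (\<rho> ^ Suc l / fact (Suc l)) * real (Suc l - 1))"
    by (subst lessThan_Suc_atMost[symmetric], subst sum.lessThan_Suc_shift) simp
  also have "\<dots> \<le> 2 * (2 * \<rho> - 1)"
    using sum_le_suminf[OF sums_summable[OF s], of "{..<X}"] sums_unique[OF s] by simp
  finally show ?thesis .
qed

lemma lower_minus_upper_model: "n \<ge> 3 \<Longrightarrow> lower_model n - upper_model n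
    = model 0 n * (7 / 24 * \<rho>\<^sup>2 / ((real n - 1 - \<rho>) * (real n - 2 - \<rho>))) + 2"
  by (simp add: lower_model_eq upper_model_eq algebra_simps)

lemma upper_model_le:
  assumes "n \<ge> 2"
  shows "upper_model n \<le> model 0 n"
proof -
  have "0 \<le> \<rho> / 2 * model 1 n"
    using model_pos[of 1 n] assms by (intro mult_nonneg_nonneg) auto
  then show ?thesis unfolding upper_model_def by linarith
qed

lemma eventually_upper_model_ge: "\<forall>\<^sub>F n in sequentially. upper_model n \<ge> model 0 n / 2"
proof -
  have "\<forall>\<^sub>F n in sequentially. upper_model n / model 0 n > 1 / 2"
    using upper_model_tendsto by (rule order_tendstoD) simp
  then show ?thesis
    using eventually_ge_at_top[of 1]
  proof eventually_elim
    case (elim n)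
    then show ?case using model_pos[of 0 n] by (simp add: less_divide_eq)
  qed
qed

text \<open>
  The models differ by the second-order term \<open>7 / 24 * model 2 n\<close> and the constant 2, and \<open>model 0 n\<close> is at
  least of order \<open>n\<^sup>2\<close>.
\<close>

lemma eventually_lower_minus_upper_model:
  "\<exists>C. \<forall>\<^sub>F n in sequentially. lower_model n - upper_model n \<le> C / real n ^ 2 * upper_model n"
proof -
  obtain c where c: "c > 0" "\<And>n. n \<ge> 4 \<Longrightarrow> model 0 n \<ge> c * real n ^ 2"
    using model_ge_square by blast
  have ev: "\<forall>\<^sub>F n in sequentially.
      7 / 24 * \<rho>\<^sup>2 / ((real n - 1 - \<rho>) * (real n - 2 - \<rho>)) \<le> 1 / real n ^ 2"
  proof -
    have "(\<lambda>n. 7 / 24 * \<rho>\<^sup>2 / ((real n - 1 - \<rho>) * (real n - 2 - \<rho>)) * real n ^ 2) \<longlonglongrightarrow> 7 / 24 * \<rho>\<^sup>2"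
      by real_asymp
    moreover have "7 / 24 * \<rho>\<^sup>2 < 1"
      using power_le_one[of \<rho> 2] rho_le_1 by simp
    ultimately have "\<forall>\<^sub>F n in sequentially.
        7 / 24 * \<rho>\<^sup>2 / ((real n - 1 - \<rho>) * (real n - 2 - \<rho>)) * real n ^ 2 < 1"
      by (rule order_tendstoD)
    then show ?thesis
      using eventually_gt_at_top[of 0]
    proof eventually_elim
      case (elim n)
      then have n: "real n ^ 2 > 0" by simp
      show ?case unfolding pos_le_divide_eq[OF n] using elim by simp
    qed
  qed
  have "\<forall>\<^sub>F n in sequentially. lower_model n - upper_model n \<le> (2 * (1 + 2 / c)) / real n ^ 2 * upper_model n"
    using ev eventually_upper_model_ge eventually_ge_at_top[of 4]
  proof eventually_elim
    case (elim n)
    have n: "real n ^ 2 > 0" and model: "model 0 n > 0" using elim model_pos[of 0 n] by simp_all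
    have "2 = 2 / c / real n ^ 2 * (c * real n ^ 2)" using c n by simp
    also have "\<dots> \<le> 2 / c / real n ^ 2 * model 0 n"
      using c elim by (intro mult_left_mono) auto
    finally have 2: "2 \<le> 2 / c / real n ^ 2 * model 0 n" .
    have "model 0 n * (7 / 24 * \<rho>\<^sup>2 / ((real n - 1 - \<rho>) * (real n - 2 - \<rho>))) \<le> model 0 n * (1 / real n ^ 2)"
      using elim model by (intro mult_left_mono) auto
    then have "lower_model n - upper_model n \<le> model 0 n * (1 / real n ^ 2) + 2 / c / real n ^ 2 * model 0 n"
      using 2 elim by (simp only: lower_minus_upper_model)
    also have "\<dots> = (1 + 2 / c) / real n ^ 2 * model 0 n"
      by (simp add: add_divide_distrib algebra_simps)
    also have "\<dots> \<le> (1 + 2 / c) / real n ^ 2 * (2 * upper_model n)"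
      using elim c by (intro mult_left_mono) auto
    finally show ?case by (simp add: mult_ac)
  qed
  then show ?thesis by blast
qed

text \<open>
  The lower model also controls the defect \<open>upper_model - growth_op upper_model\<close> in \<open>ratio_convergent\<close>: since
  \<open>growth_op\<close> increases the lower model and decreases the upper one, the defect is at most
  \<open>growth_op (lower_model - upper_model)\<close>, and the gap between the models is of relative order \<open>1 / n\<^sup>2\<close>.
\<close>

lemma tree_count_over_model_limit:
  assumes lower: "\<And>k. 40 \<le> k \<Longrightarrow> k < 80 \<Longrightarrow> \<alpha> * lower_model k \<le> real (tree_count k)"
    and upper: "\<And>k. 40 \<le> k \<Longrightarrow> k < 80 \<Longrightarrow> real (tree_count k) \<le> \<beta> * upper_model k"
    and "\<alpha> \<ge> 0" "\<beta> \<ge> 0"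
  shows "\<exists>L. \<alpha> \<le> L \<and> L \<le> \<beta> \<and> (\<lambda>n. real (tree_count n) / model 0 n) \<longlonglongrightarrow> L"
proof -
  have le: "real (tree_count n) \<le> \<beta> * upper_model n" if "n \<ge> 40" for n
  proof (rule growth_op_comparison[OF _ _ _ that])
    show "growth_op (\<lambda>k. \<beta> * upper_model k) m \<le> \<beta> * upper_model m" if "m \<ge> 2 * 40" for m
      unfolding growth_op_cmult using that assms by (intro mult_left_mono growth_op_upper_model) auto
  qed (use upper growth_op_tree_count in auto)
  have ge: "\<alpha> * lower_model n \<le> real (tree_count n)" if "n \<ge> 40" for n
  proof (rule growth_op_comparison[OF _ _ _ that])
    show "\<alpha> * lower_model m \<le> growth_op (\<lambda>k. \<alpha> * lower_model k) m" if "m \<ge> 2 * 40" for m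
      unfolding growth_op_cmult using that assms by (intro mult_left_mono growth_op_lower_model) auto
  qed (use lower growth_op_tree_count in auto)
  obtain C where C: "\<forall>\<^sub>F n in sequentially. lower_model n - upper_model n \<le> C / real n ^ 2 * upper_model n"
    using eventually_lower_minus_upper_model by blast
  \<comment> \<open>a nonnegative constant makes the bound decreasing in the index\<close>
  define C' where "C' = max C 0"
  from C eventually_upper_model_ge obtain N0 where
    N0: "\<And>n. n \<ge> N0 \<Longrightarrow> lower_model n - upper_model n \<le> C / real n ^ 2 * upper_model n"
        "\<And>n. n \<ge> N0 \<Longrightarrow> upper_model n \<ge> model 0 n / 2"
    unfolding eventually_sequentially by (metis le_trans linorder_le_cases)
  define N where "N = max N0 40"
  have N: "N \<ge> N0" "N \<ge> 40" by (simp_all add: N_def)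
  have pos: "upper_model n > 0" if "n \<ge> N" for n
    using N0(2)[of n] model_pos[of 0 n] that N by simp
  have gap: "lower_model n - upper_model n \<le> C' / real n ^ 2 * upper_model n" if "n \<ge> N" for n
  proof -
    have "C / real n ^ 2 * upper_model n \<le> C' / real n ^ 2 * upper_model n"
      using pos[OF that] by (intro mult_right_mono divide_right_mono) (auto simp: C'_def)
    then show ?thesis using N0(1)[of n] that N by simp
  qed
  have "convergent (\<lambda>n. real (tree_count n) / upper_model n)"
  proof (rule ratio_convergent[where N = N and \<beta> = \<beta> and C = "4 * C'" and \<theta> = "2 * (2 * \<rho> - 1)"
        and q = "\<lambda>l. 2 * (\<rho> ^ l / fact l)"])
    show "\<bar>upper_model n - growth_op upper_model n\<bar> \<le> 4 * C' / real n ^ 2 * upper_model n" if n: "n \<ge> 2 * N" for n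
    proof -
      have sup: "growth_op upper_model n \<le> upper_model n" and sb: "lower_model n \<le> growth_op lower_model n"
        using n N by (auto intro!: growth_op_upper_model growth_op_lower_model)
      have nonneg: "upper_model n \<le> lower_model n"
      proof -
        have "0 \<le> model 0 n * (7 / 24 * \<rho>\<^sup>2 / ((real n - 1 - \<rho>) * (real n - 2 - \<rho>)))"
          using n N model_pos[of 0 n] rho_le_1
          by (intro mult_nonneg_nonneg[of "model 0 n"] divide_nonneg_nonneg mult_nonneg_nonneg) auto
        then show ?thesis using lower_minus_upper_model[of n] n N by simp
      qed
      have "upper_model n - growth_op upper_model n \<le> growth_op lower_model n - growth_op upper_model n - (lower_model n - upper_model n)"
        using sb by simp
      also have "\<dots> \<le> growth_op (\<lambda>k. lower_model k - upper_model k) n"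
        using nonneg by (simp add: growth_op_diff)
      also have "\<dots> \<le> growth_op (\<lambda>k. 4 * C' / real n ^ 2 * upper_model k) n"
      proof (rule growth_op_mono)
        fix k assume k: "k < n" "n \<le> 2 * k"
        \<comment> \<open>from \<open>2 * k \<ge> n\<close>, at the cost of the factor 4\<close>
        have "C' / real k ^ 2 \<le> C' / (real n / 2) ^ 2"
          using k n N by (intro divide_left_mono power_mono mult_pos_pos) (auto simp: C'_def)
        also have "\<dots> = 4 * C' / real n ^ 2" by (simp add: power_divide)
        finally have "C' / real k ^ 2 * upper_model k \<le> 4 * C' / real n ^ 2 * upper_model k"
          using pos[of k] k n by (intro mult_right_mono) auto
        then show "lower_model k - upper_model k \<le> 4 * C' / real n ^ 2 * upper_model k"
          using gap[of k] k n by simp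
      qed
      also have "\<dots> = 4 * C' / real n ^ 2 * growth_op upper_model n"
        by (rule growth_op_cmult)
      also have "\<dots> \<le> 4 * C' / real n ^ 2 * upper_model n"
        using sup by (intro mult_left_mono) (auto simp: C'_def)
      finally show ?thesis using sup by simp
    qed
    show "real (k choose (n - k)) * upper_model k \<le> 2 * (\<rho> ^ (n - k) / fact (n - k)) * upper_model n"
      if n: "n \<ge> 2 * N" "k + 2 \<le> n" "n \<le> 2 * k" for n k
    proof -
      have "real (k choose (n - k)) * upper_model k \<le> real (k choose (n - k)) * model 0 k"
        using n N by (intro mult_left_mono upper_model_le) auto
      also have "\<dots> \<le> \<rho> ^ (n - k) / fact (n - k) * model 0 n"
        using n by (intro model_ratio_bound) auto
      also have "\<dots> \<le> \<rho> ^ (n - k) / fact (n - k) * (2 * upper_model n)"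
        using N0(2)[of n] n N by (intro mult_left_mono) auto
      finally show ?thesis by (simp add: mult_ac)
    qed
    show "\<bar>real (tree_count n)\<bar> \<le> \<beta> * upper_model n" if "n \<ge> N" for n
      using le[of n] that N by simp
    show "2 * (2 * \<rho> - 1) < 1" using rho_bounds by simp
  qed (use N pos growth_op_tree_count weights_sum_le in auto)
  then obtain L where L: "(\<lambda>n. real (tree_count n) / upper_model n) \<longlonglongrightarrow> L"
    by (auto simp: convergent_def)
  have "(\<lambda>n. real (tree_count n) / upper_model n * (upper_model n / model 0 n)) \<longlonglongrightarrow> L * 1"
    by (intro tendsto_mult L upper_model_tendsto)
  moreover have "\<forall>\<^sub>F n in sequentially. real (tree_count n) / upper_model n * (upper_model n / model 0 n) = real (tree_count n) / model 0 n"
    using eventually_ge_at_top[of N] by eventually_elim (use pos in force)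
  ultimately have lim: "(\<lambda>n. real (tree_count n) / model 0 n) \<longlonglongrightarrow> L"
    unfolding mult_1_right by (rule Lim_transform_eventually)
  have "L \<le> \<beta> * 1"
  proof (rule LIMSEQ_le[OF lim])
    show "(\<lambda>n. \<beta> * (upper_model n / model 0 n)) \<longlonglongrightarrow> \<beta> * 1"
      by (intro tendsto_intros upper_model_tendsto)
    show "\<exists>M. \<forall>n\<ge>M. real (tree_count n) / model 0 n \<le> \<beta> * (upper_model n / model 0 n)"
      using le model_pos[of 0] by (intro exI[of _ 40]) (auto simp: divide_right_mono less_imp_le)
  qed
  moreover have "\<alpha> * 1 \<le> L"
  proof (rule LIMSEQ_le[OF _ lim])
    show "(\<lambda>n. \<alpha> * (lower_model n / model 0 n)) \<longlonglongrightarrow> \<alpha> * 1"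
      by (intro tendsto_intros lower_model_tendsto)
    show "\<exists>M. \<forall>n\<ge>M. \<alpha> * (lower_model n / model 0 n) \<le> real (tree_count n) / model 0 n"
      using ge model_pos[of 0] by (intro exI[of _ 40]) (auto simp: divide_right_mono less_imp_le)
  qed
  ultimately show ?thesis using lim by auto
qed

section \<open>Numerical control of Gamma\<close>

text \<open>
  Gauss's limit formula for Gamma at \<open>1 - \<rho>\<close>, shifted by two steps of the functional equation.
\<close>

lemma Gamma_ratio_tendsto: "(\<lambda>n. Gamma (real n - \<rho>) / (real n powr (- \<rho>) * fact (n - 1))) \<longlonglongrightarrow> 1"
proof -
  define z where "z = 1 - \<rho>"
  have z: "z > 0" using rho_le_1 by (simp add: z_def)
  have Gz: "Gamma z > 0" using z by (rule Gamma_real_pos)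
  have "(\<lambda>n. Gamma z / Gamma_series z n) \<longlonglongrightarrow> Gamma z / Gamma z"
    by (intro tendsto_intros Gamma_series_LIMSEQ) (use Gz in simp)
  then have lim: "(\<lambda>n. Gamma z / Gamma_series z n) \<longlonglongrightarrow> 1" using Gz by simp
  have "(\<lambda>n. Gamma z / Gamma_series z n * (real n ^ 2 / ((real n + 1 - \<rho>) * (real n - \<rho>)))) \<longlonglongrightarrow> 1 * 1"
    by (intro tendsto_mult lim) real_asymp
  moreover have "\<forall>\<^sub>F n in sequentially.
      Gamma z / Gamma_series z n * (real n ^ 2 / ((real n + 1 - \<rho>) * (real n - \<rho>)))
      = Gamma (real n - \<rho>) / (real n powr (- \<rho>) * fact (n - 1))"
    using eventually_ge_at_top[of 1]
  proof eventually_elim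
    case (elim n)
    have n: "real n - \<rho> > 0" "real n > 0" using elim rho_le_1 by simp_all
    have "pochhammer z (Suc n) = Gamma (z + real (Suc n)) / Gamma z"
      using z by (intro pochhammer_Gamma) (auto elim!: nonpos_Ints_cases)
    also have "z + real (Suc n) = (real n - \<rho> + 1) + 1" by (simp add: z_def)
    also have "Gamma \<dots> = (real n + 1 - \<rho>) * ((real n - \<rho>) * Gamma (real n - \<rho>))"
      using n by (subst Gamma_plus1, force elim!: nonpos_Ints_cases)+ (simp add: algebra_simps)
    finally have p: "pochhammer z (Suc n) = (real n + 1 - \<rho>) * ((real n - \<rho>) * Gamma (real n - \<rho>)) / Gamma z" .
    have e: "exp (z * ln (real n)) = real n * real n powr (- \<rho>)"
    proof -
      have "exp (z * ln (real n)) = real n powr (1 + - \<rho>)"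
        using n by (simp add: powr_def z_def)
      also have "\<dots> = real n powr 1 * real n powr (- \<rho>)" by (rule powr_add)
      finally show ?thesis using n by simp
    qed
    have f: "fact n = real n * fact (n - 1)"
      using elim by (simp add: fact_reduce)
    have "Gamma_series z n = (real n * real n powr (- \<rho>)) * (real n * fact (n - 1))
        / ((real n + 1 - \<rho>) * ((real n - \<rho>) * Gamma (real n - \<rho>)) / Gamma z)"
      by (simp add: Gamma_series_def p e f)
    moreover have "real n + 1 - \<rho> \<noteq> 0" "real n - \<rho> \<noteq> 0" "real n powr (- \<rho>) \<noteq> 0"
      using n by auto
    moreover have "y / (p * f / (a * (c * g) / y)) * (q / (a * c)) = g / (p / q * f)"
      if "y \<noteq> 0" "p \<noteq> 0" "f \<noteq> 0" "a \<noteq> 0" "c \<noteq> 0" "q \<noteq> 0" for y p f a c g q :: real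
      using that by (simp add: divide_simps)
    note this[of "Gamma z" "real n * real n powr (- \<rho>) * real n" "fact (n - 1)"
        "real n + 1 - \<rho>" "real n - \<rho>" "real n ^ 2" "Gamma (real n - \<rho>)"]
    ultimately show ?case using Gz n(2)
      by (simp add: power2_eq_square mult_ac)
  qed
  ultimately show ?thesis by (simp add: filterlim_cong)
qed

text \<open>
  The quotient of \<open>Gamma (n - \<rho>)\<close> by \<open>fact (n - 1) / (n - s) powr \<rho>\<close> tends to 1 for every shift \<open>s\<close>.  For
  \<open>s = (1 + \<rho>) / 2\<close> its deviation from 1 is of order \<open>1 / n\<^sup>2\<close>, and shifts close to this value on either
  side make the quotient monotone, which yields bounds for Gamma at a finite \<open>n\<close>.
\<close>

definition shifted_ratio :: "real \<Rightarrow> nat \<Rightarrow> real" where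
  "shifted_ratio s n = ln (Gamma (real n - \<rho>) * (real n - s) powr \<rho> / fact (n - 1))"

lemma shifted_ratio_tendsto: "shifted_ratio s \<longlonglongrightarrow> 0"
proof -
  have "(\<lambda>n. Gamma (real n - \<rho>) / (real n powr (- \<rho>) * fact (n - 1)) * ((real n - s) / real n) powr \<rho>) \<longlonglongrightarrow> 1 * 1"
    by (intro tendsto_mult Gamma_ratio_tendsto) real_asymp
  moreover have "\<forall>\<^sub>F n in sequentially.
      Gamma (real n - \<rho>) / (real n powr (- \<rho>) * fact (n - 1)) * ((real n - s) / real n) powr \<rho>
      = Gamma (real n - \<rho>) * (real n - s) powr \<rho> / fact (n - 1)"
    using eventually_ge_at_top[of "max 1 (nat \<lceil>s\<rceil>)"]
  proof eventually_elim
    case (elim n)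
    then have "real n \<ge> s" "real n > 0" by linarith+
    then show ?case by (simp add: powr_divide powr_minus_divide)
  qed
  ultimately have "(\<lambda>n. Gamma (real n - \<rho>) * (real n - s) powr \<rho> / fact (n - 1)) \<longlonglongrightarrow> 1"
    by (simp add: filterlim_cong)
  then have "(\<lambda>n. ln (Gamma (real n - \<rho>) * (real n - s) powr \<rho> / fact (n - 1))) \<longlonglongrightarrow> ln 1"
    by (rule tendsto_ln) simp
  then show ?thesis by (simp add: shifted_ratio_def[abs_def])
qed

definition ratio_step :: "real \<Rightarrow> real \<Rightarrow> real" where
  "ratio_step s x = \<rho> * (ln (x + 1 - s) - ln (x - s)) + (ln (x - \<rho>) - ln x)"

lemma shifted_ratio_Suc:
  assumes "n \<ge> 1" "s < 1"
  shows "shifted_ratio s (Suc n) = shifted_ratio s n + ratio_step s (real n)"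
proof -
  have n: "real n - \<rho> > 0" "real n > 0" "real n - s > 0" "real n + 1 - s > 0" using assms rho_le_1 by simp_all
  have "Gamma (real n - \<rho> + 1) = (real n - \<rho>) * Gamma (real n - \<rho>)"
    using n by (intro Gamma_plus1) (auto elim!: nonpos_Ints_cases)
  then have g: "Gamma (real (Suc n) - \<rho>) = (real n - \<rho>) * Gamma (real n - \<rho>)" by (simp add: algebra_simps)
  have f: "fact (Suc n - 1) = real n * fact (n - 1)"
    using assms by (simp add: fact_reduce)
  define \<gamma> where "\<gamma> = Gamma (real n - \<rho>)"
  have pos: "\<gamma> > 0" unfolding \<gamma>_def using n by (intro Gamma_real_pos)
  have "shifted_ratio s (Suc n) = ln (real n - \<rho>) + ln \<gamma> + \<rho> * ln (real n + 1 - s)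
      - (ln (real n) + ln (fact (n - 1)))"
  proof -
    have "real (Suc n) - s = real n + 1 - s" by simp
    then show ?thesis
      unfolding shifted_ratio_def g f \<gamma>_def[symmetric] using n pos
      by (simp only:) (simp add: ln_div ln_mult ln_powr)
  qed
  moreover have "shifted_ratio s n = ln \<gamma> + \<rho> * ln (real n - s) - ln (fact (n - 1))"
    unfolding shifted_ratio_def \<gamma>_def[symmetric] using n pos by (simp add: ln_div ln_mult ln_powr)
  ultimately show ?thesis by (simp add: ratio_step_def algebra_simps)
qed

lemma ratio_step_deriv:
  assumes "x \<ge> 1" "s < 1"
  shows "(ratio_step s has_real_derivative \<rho> * (1 / (x * (x - \<rho>)) - 1 / ((x - s) * (x + 1 - s)))) (at x)"
proof -
  have x: "x > 0" "x - \<rho> > 0" "x - s > 0" "x + 1 - s > 0" using assms rho_le_1 by simp_all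
  have "(ratio_step s has_real_derivative \<rho> * (1 / (x + 1 - s) - 1 / (x - s)) + (1 / (x - \<rho>) - 1 / x)) (at x)"
    unfolding ratio_step_def using x by (auto intro!: derivative_eq_intros)
  moreover have 1: "1 / (x + 1 - s) - 1 / (x - s) = - (1 / ((x - s) * (x + 1 - s)))"
    using x by (simp add: field_simps)
  moreover have 2: "1 / (x - \<rho>) - 1 / x = \<rho> * (1 / (x * (x - \<rho>)))"
    using x by (simp add: field_simps)
  moreover have "\<rho> * (- B) + \<rho> * A = \<rho> * (A - B)" for A B
    by (simp add: algebra_simps)
  ultimately show ?thesis by (simp only:)
qed

lemma ratio_step_tendsto: "(ratio_step s \<longlongrightarrow> 0) at_top"
  unfolding ratio_step_def by real_asymp

text \<open>
  A function that decreases to 0 is nonnegative.  The sign of the derivative is that of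
  \<open>(x - s) * (x + 1 - s) - x * (x - \<rho>)\<close>, which is linear in \<open>x\<close>.
\<close>

lemma ratio_step_nonneg:
  assumes "x \<ge> 1" "s < 1" "1 - 2 * s + \<rho> \<le> 0" "s \<ge> 0"
  shows "ratio_step s x \<ge> 0"
proof (rule tendsto_upperbound[OF ratio_step_tendsto])
  show "\<forall>\<^sub>F y in at_top. ratio_step s y \<le> ratio_step s x"
    using eventually_ge_at_top[of x]
  proof eventually_elim
    case (elim y)
    show ?case
    proof (rule DERIV_nonpos_imp_nonincreasing[OF elim])
      fix t assume t: "x \<le> t" "t \<le> y"
      have t1: "t \<ge> 1" using t assms by simp
      have "(t - s) * (t + 1 - s) = t * (t - \<rho>) + ((1 - 2 * s + \<rho>) * t - s * (1 - s))"
        by (simp add: algebra_simps)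
      moreover have "(1 - 2 * s + \<rho>) * t \<le> 0" using assms t1 by (intro mult_nonpos_nonneg) auto
      moreover have "s * (1 - s) \<ge> 0" using assms by simp
      ultimately have "(t - s) * (t + 1 - s) \<le> t * (t - \<rho>)" by linarith
      then have "1 / (t * (t - \<rho>)) \<le> 1 / ((t - s) * (t + 1 - s))"
        using t1 assms rho_le_1 by (intro divide_left_mono mult_pos_pos) auto
      then have "\<rho> * (1 / (t * (t - \<rho>)) - 1 / ((t - s) * (t + 1 - s))) \<le> 0"
        by (simp add: mult_le_0_iff)
      then show "\<exists>d. (ratio_step s has_real_derivative d) (at t) \<and> d \<le> 0"
        using ratio_step_deriv[OF t1 assms(2)] by blast
    qed
  qed
qed simp

lemma ratio_step_nonpos:
  assumes "x \<ge> 1" "0 \<le> s" "s < 1" "1 - 2 * s + \<rho> \<ge> 0" "(1 - 2 * s + \<rho>) * x \<ge> s * (1 - s)"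
  shows "ratio_step s x \<le> 0"
proof (rule tendsto_lowerbound[OF ratio_step_tendsto])
  show "\<forall>\<^sub>F y in at_top. ratio_step s x \<le> ratio_step s y"
    using eventually_ge_at_top[of x]
  proof eventually_elim
    case (elim y)
    show ?case
    proof (rule DERIV_nonneg_imp_nondecreasing[OF elim])
      fix t assume t: "x \<le> t" "t \<le> y"
      have t1: "t \<ge> 1" using t assms by simp
      have "(t - s) * (t + 1 - s) = t * (t - \<rho>) + ((1 - 2 * s + \<rho>) * t - s * (1 - s))"
        by (simp add: algebra_simps)
      moreover have "(1 - 2 * s + \<rho>) * x \<le> (1 - 2 * s + \<rho>) * t" using assms t by (intro mult_left_mono) auto
      ultimately have "t * (t - \<rho>) \<le> (t - s) * (t + 1 - s)" using assms(5) by linarith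
      then have "1 / ((t - s) * (t + 1 - s)) \<le> 1 / (t * (t - \<rho>))"
        using t1 assms rho_le_1 by (intro divide_left_mono mult_pos_pos) auto
      then have "\<rho> * (1 / (t * (t - \<rho>)) - 1 / ((t - s) * (t + 1 - s))) \<ge> 0"
        by (intro mult_nonneg_nonneg) auto
      then show "\<exists>d. (ratio_step s has_real_derivative d) (at t) \<and> d \<ge> 0"
        using ratio_step_deriv[OF t1 assms(3)] by blast
    qed
  qed
qed simp

text \<open>
  The logarithmic quotient increases to its limit 0.
\<close>

lemma Gamma_upper:
  assumes "n \<ge> 1" "0 \<le> s" "s < 1" "1 - 2 * s + \<rho> \<le> 0"
  shows "Gamma (real n - \<rho>) \<le> fact (n - 1) / (real n - s) powr \<rho>"
proof -
  have "shifted_ratio s n \<le> 0"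
  proof (rule LIMSEQ_le_const[OF shifted_ratio_tendsto])
    have "shifted_ratio s n \<le> shifted_ratio s m" if "m \<ge> n" for m
      using that
    proof (induction m rule: dec_induct)
      case (step m)
      then show ?case
        using shifted_ratio_Suc[of m s] ratio_step_nonneg[of "real m" s] assms by simp
    qed simp
    then show "\<exists>N. \<forall>m\<ge>N. shifted_ratio s n \<le> shifted_ratio s m" by blast
  qed
  moreover have pos: "real n - s > 0" "Gamma (real n - \<rho>) > 0"
    using assms rho_le_1 by (auto intro!: Gamma_real_pos)
  ultimately have "Gamma (real n - \<rho>) * (real n - s) powr \<rho> / fact (n - 1) \<le> 1"
    by (subst (asm) shifted_ratio_def, subst (asm) ln_le_zero_iff) auto
  then show ?thesis using pos by (simp add: divide_le_eq le_divide_eq)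
qed

text \<open>
  The logarithmic quotient decreases to its limit 0.
\<close>

lemma Gamma_lower:
  assumes "n \<ge> 1" "0 \<le> s" "s < 1" "1 - 2 * s + \<rho> \<ge> 0" "(1 - 2 * s + \<rho>) * real n \<ge> s * (1 - s)"
  shows "Gamma (real n - \<rho>) \<ge> fact (n - 1) / (real n - s) powr \<rho>"
proof -
  have "shifted_ratio s n \<ge> 0"
  proof (rule LIMSEQ_le_const2[OF shifted_ratio_tendsto])
    have "shifted_ratio s m \<le> shifted_ratio s n" if "m \<ge> n" for m
      using that
    proof (induction m rule: dec_induct)
      case (step m)
      have "(1 - 2 * s + \<rho>) * real n \<le> (1 - 2 * s + \<rho>) * real m"
        using step assms by (intro mult_left_mono) auto
      then show ?case
        using step shifted_ratio_Suc[of m s] ratio_step_nonpos[of "real m" s] assms by simp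
    qed simp
    then show "\<exists>N. \<forall>m\<ge>N. shifted_ratio s m \<le> shifted_ratio s n" by blast
  qed
  moreover have pos: "real n - s > 0" "Gamma (real n - \<rho>) > 0"
    using assms rho_le_1 by (auto intro!: Gamma_real_pos)
  ultimately have "Gamma (real n - \<rho>) * (real n - s) powr \<rho> / fact (n - 1) \<ge> 1"
    by (subst (asm) shifted_ratio_def, subst (asm) ln_ge_zero_iff) auto
  then show ?thesis using pos by (simp add: divide_le_eq le_divide_eq)
qed

section \<open>The window of initial values\<close>

fun add_padded :: "int list \<Rightarrow> int list \<Rightarrow> int list" where
  "add_padded [] ys = ys"
| "add_padded (x # xs) [] = x # xs"
| "add_padded (x # xs) (y # ys) = (x + y) # add_padded xs ys"

fun dot :: "int list \<Rightarrow> int list \<Rightarrow> int" where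
  "dot (x # xs) (y # ys) = x * y + dot xs ys"
| "dot _ _ = 0"

text \<open>
  For size \<open>n\<close> the argument \<open>r'\<close> holds the shallow diagonal \<open>(n - i) choose i\<close> of Pascal's triangle for
  \<open>i = 0, 1, \<dots>\<close>, \<open>r\<close> the preceding diagonal, and \<open>bs\<close> the counts for the sizes \<open>n - 1, \<dots>, 0\<close>.  Pascal's
  rule turns two diagonals into the next one by a single addition.
\<close>

fun count_table :: "nat \<Rightarrow> int list \<Rightarrow> int list \<Rightarrow> int list \<Rightarrow> int list" where
  "count_table 0 r' r bs = bs"
| "count_table (Suc m) r' r bs = count_table m (add_padded r' (0 # r)) r' (dot (tl r') bs # bs)"

text \<open>
  Lists padded with zeros, as \<open>add_padded\<close> and \<open>dot\<close> treat them.
\<close>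

definition entry :: "int list \<Rightarrow> nat \<Rightarrow> int" where
  "entry xs i = (if i < length xs then xs ! i else 0)"

lemma entry_simps [simp]:
  "entry [] i = 0" "entry (x # xs) 0 = x" "entry (x # xs) (Suc i) = entry xs i"
  by (simp_all add: entry_def)

lemma entry_add_padded: "entry (add_padded xs ys) i = entry xs i + entry ys i"
proof (induction xs ys arbitrary: i rule: add_padded.induct)
  case (3 x xs y ys)
  then show ?case by (cases i) auto
qed auto

lemma entry_tl: "entry (tl xs) i = entry xs (Suc i)"
  by (cases xs) auto

lemma dot_eq: "dot xs ys = (\<Sum>i<length ys. entry xs i * entry ys i)"
proof (induction xs ys rule: dot.induct)
  case (1 x xs y ys)
  have "(\<Sum>i<length (y # ys). entry (x # xs) i * entry (y # ys) i)
      = x * y + (\<Sum>i<length ys. entry xs i * entry ys i)"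
    unfolding length_Cons by (subst sum.lessThan_Suc_shift) simp
  then show ?case using 1 by simp
qed auto

lemma count_table_correct:
  assumes "n \<ge> 2"
    and "\<And>i. entry r' i = int ((n - i) choose i)" "\<And>i. entry r i = int ((n - 1 - i) choose i)"
    and "bs = map (\<lambda>k. int (tree_count k)) (rev [0..<n])"
  shows "count_table m r' r bs = map (\<lambda>k. int (tree_count k)) (rev [0..<n + m])"
  using assms
proof (induction m arbitrary: n r' r bs)
  case (Suc m)
  have row: "entry (add_padded r' (0 # r)) i = int ((Suc n - i) choose i)" for i
  proof (cases i)
    case (Suc j)
    show ?thesis
    proof (cases "j < n")
      case True
      then obtain k where k: "n = Suc (j + k)" by (metis less_iff_Suc_add)
      show ?thesis using Suc.prems(2)[of i] Suc.prems(3)[of j]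
        by (simp add: entry_add_padded k \<open>i = Suc j\<close>)
    next
      case False
      then show ?thesis using Suc.prems(2)[of i] Suc.prems(3)[of j] Suc Suc.prems(1)
        by (simp add: entry_add_padded)
    qed
  qed (use Suc.prems(2)[of 0] in \<open>simp add: entry_add_padded\<close>)
  have "dot (tl r') bs = (\<Sum>i<n. int ((n - Suc i) choose (Suc i)) * int (tree_count (n - Suc i)))"
    unfolding dot_eq entry_tl Suc.prems(2) using Suc.prems(4)
    by (intro sum.cong) (auto simp: entry_def rev_nth)
  also have "\<dots> = (\<Sum>k<n. int (k choose (n - k)) * int (tree_count k))"
    by (rule sum.reindex_bij_witness[of _ "\<lambda>k. n - Suc k" "\<lambda>i. n - Suc i"]) auto
  also have "\<dots> = int (tree_count n)"
    using Suc.prems(1) by (simp add: tree_count_rec[of n])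
  finally have "dot (tl r') bs # bs = map (\<lambda>k. int (tree_count k)) (rev [0..<Suc n])"
    using Suc.prems(4) by simp
  then have "count_table m (add_padded r' (0 # r)) r' (dot (tl r') bs # bs)
      = map (\<lambda>k. int (tree_count k)) (rev [0..<Suc n + m])"
    using Suc.prems(1,2) row by (intro Suc.IH) auto
  then show ?case by simp
qed simp

lemma count_table_eq: "count_table m [1, 1] [1] [1, 0] = map (\<lambda>k. int (tree_count k)) (rev [0..<2 + m])"
proof (rule count_table_correct)
  fix i :: nat
  consider "i = 0" | "i = 1" | "i \<ge> 2" by linarith
  then show "entry [1, 1] i = int ((2 - i) choose i)"
    by cases (auto simp: entry_def)
  show "entry [1] i = int ((2 - 1 - i) choose i)"
    by (cases i) (auto simp: entry_def)
  have "[0..<2] = [0, 1::nat]" by (simp add: upt_rec)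
  then show "[1, 0] = map (\<lambda>k. int (tree_count k)) (rev [0..<2])"
    using tree_count_0 tree_count_1 by simp
qed simp

text \<open>
  One step of \<open>model 0 k = model 0 (k + 1) * \<rho> / (k - \<rho>)\<close>, for upper bounds of the model in integers; the
  numerals are a decimal upper bound of \<open>\<rho>\<close>, scaled by \<open>10 ^ 10\<close>.  The values exceed \<open>10 ^ 50\<close>, so
  rounding to integers costs nothing.
\<close>

definition step_hi :: "int \<Rightarrow> int \<Rightarrow> int" where
  "step_hi k U = U * 6931471806 div (10000000000 * k - 6931471806) + 1"

definition step_lo :: "int \<Rightarrow> int \<Rightarrow> int" where
  "step_lo k L = L * 6931471805 div (10000000000 * k - 6931471805)"

text \<open>
  The arguments \<open>U\<close> and \<open>L\<close> enclose \<open>model 0 k\<close>, and \<open>x\<close> is the tree count for \<open>k\<close>.  With all denominators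
  cleared, the two inequalities compare \<open>x\<close> with \<open>0.647803\<close> times the lower model and \<open>0.6479\<close> times the upper
  model.  Here \<open>X\<close> and \<open>Y\<close> enclose \<open>10 ^ 7 * (k - 1 - \<rho>)\<close>, \<open>Z\<close> is below \<open>10 ^ 7 * (k - 2 - \<rho>)\<close>, the numbers
  2402265 and 2402267 enclose \<open>10 ^ 7 * \<rho>\<^sup>2 / 2\<close>, and \<open>0.14013216\<close> bounds \<open>7 / 24 * \<rho>\<^sup>2\<close>.

  Both factors lie in the required range of radius \<open>5 / 10 ^ 5\<close> about \<open>0.647852\<close>.  The limit is about
  \<open>0.647808\<close>, close to the lower end of this range, which is why the lower model needs its second-order
  term and the upper model does not.
\<close>

fun window_check :: "int \<Rightarrow> int \<Rightarrow> int \<Rightarrow> int list \<Rightarrow> bool" where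
  "window_check k U L [] \<longleftrightarrow> True"
| "window_check k U L (x # xs) \<longleftrightarrow>
     (let X = 10000000 * k - 16931471; Y = 10000000 * k - 16931472; Z = 10000000 * k - 26931472 in
      647803 * (U * (X * Y * Z - 2402265 * Y * Z + 14013216000000 * X) + X * Y * Z) \<le> 1000000 * x * (X * Y * Z)
      \<and> 10000 * x * Y \<le> 6479 * (L * (Y - 2402267) - Y)
      \<and> window_check (k - 1) (step_hi (k - 1) U) (step_lo (k - 1) L) xs)"

lemma model_step_down:
  assumes "k \<ge> 1"
  shows "model 0 k = model 0 (Suc k) * (\<rho> / (real k - \<rho>))"
  using model_Suc[of 0 k] assms rho_le_1 by simp

lemma step_hi:
  assumes "k \<ge> 1" "model 0 (Suc k) \<le> real_of_int U"
  shows "model 0 k \<le> real_of_int (step_hi (int k) U)"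
proof -
  define d where "d = 10000000000 * int k - 6931471806"
  have rd: "real_of_int d = 10000000000 * real k - 6931471806" by (simp add: d_def)
  have d: "real_of_int d > 0" using assms unfolding rd by simp
  have "\<rho> * real_of_int d \<le> 6931471806 * (real k - \<rho>)"
  proof -
    have "\<rho> * (10000000000 * real k) \<le> 6931471806 * real k"
      using mult_right_mono[OF rho_bounds(2), of "real k"] by simp
    then show ?thesis unfolding rd by (simp add: algebra_simps)
  qed
  then have r: "\<rho> / (real k - \<rho>) \<le> 6931471806 / real_of_int d"
    using d assms rho_le_1 by (simp add: divide_le_eq le_divide_eq mult_ac)
  have "model 0 k \<le> real_of_int U * (6931471806 / real_of_int d)"
    unfolding model_step_down[OF assms(1)]
  proof (rule mult_mono[OF assms(2) r])
    show "0 \<le> real_of_int U" using assms(2) model_pos[of 0 "Suc k"] by simp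
    show "0 \<le> \<rho> / (real k - \<rho>)" using assms rho_le_1 by simp
  qed
  also have "\<dots> = real_of_int (U * 6931471806) / real_of_int d" by simp
  also have "\<dots> \<le> real_of_int (U * 6931471806 div d) + 1"
    using real_of_int_div3[of "U * 6931471806" d] by simp
  finally show ?thesis by (simp add: step_hi_def d_def)
qed

lemma step_lo:
  assumes "k \<ge> 1" "real_of_int L \<le> model 0 (Suc k)"
  shows "real_of_int (step_lo (int k) L) \<le> model 0 k"
proof -
  define d where "d = 10000000000 * int k - 6931471805"
  have rd: "real_of_int d = 10000000000 * real k - 6931471805" by (simp add: d_def)
  have d: "real_of_int d > 0" using assms unfolding rd by simp
  have "6931471805 * (real k - \<rho>) \<le> \<rho> * real_of_int d"
  proof -
    have "6931471805 * real k \<le> \<rho> * (10000000000 * real k)"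
      using mult_right_mono[OF rho_bounds(1), of "real k"] by simp
    then show ?thesis unfolding rd by (simp add: algebra_simps)
  qed
  then have r: "6931471805 / real_of_int d \<le> \<rho> / (real k - \<rho>)"
    using d assms rho_le_1 by (simp add: divide_le_eq le_divide_eq mult_ac)
  have "real_of_int (L * 6931471805 div d) \<le> real_of_int (L * 6931471805) / real_of_int d"
    by (rule real_of_int_div4)
  also have "\<dots> = real_of_int L * (6931471805 / real_of_int d)" by simp
  also have "\<dots> \<le> model 0 (Suc k) * (6931471805 / real_of_int d)"
    using assms d by (intro mult_right_mono) auto
  also have "\<dots> \<le> model 0 (Suc k) * (\<rho> / (real k - \<rho>))"
    using r model_pos[of 0 "Suc k"] by (intro mult_left_mono) auto
  also have "\<dots> = model 0 k"
    using model_step_down[OF assms(1)] by simp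
  finally show ?thesis by (simp add: step_lo_def d_def)
qed

lemma rho_square_bounds: "4804530 / 10000000 \<le> \<rho>\<^sup>2" "\<rho>\<^sup>2 \<le> 48045302 / 100000000"
proof -
  have "(6931471805 / 10000000000)\<^sup>2 \<le> \<rho>\<^sup>2" "\<rho>\<^sup>2 \<le> (6931471806 / 10000000000)\<^sup>2"
    using rho_bounds by (auto intro!: power_mono)
  then show "4804530 / 10000000 \<le> \<rho>\<^sup>2" "\<rho>\<^sup>2 \<le> 48045302 / 100000000"
    by (simp_all add: power2_eq_square)
qed

lemma window_check_single:
  fixes k :: nat and U L x :: int
  assumes k: "k \<ge> 10" and model: "real_of_int L \<le> model 0 k" "model 0 k \<le> real_of_int U"
  defines "X \<equiv> 10000000 * int k - 16931471" and "Y \<equiv> 10000000 * int k - 16931472"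
    and "Z \<equiv> 10000000 * int k - 26931472"
  shows "647803 * (U * (X * Y * Z - 2402265 * Y * Z + 14013216000000 * X) + X * Y * Z) \<le> 1000000 * x * (X * Y * Z)
      \<Longrightarrow> 647803 / 1000000 * lower_model k \<le> real_of_int x"
    and "10000 * x * Y \<le> 6479 * (L * (Y - 2402267) - Y)
      \<Longrightarrow> real_of_int x \<le> 6479 / 10000 * upper_model k"
proof -
  define y where "y = real k - 1 - \<rho>"
  define z where "z = real k - 2 - \<rho>"
  define X' where "X' = 10000000 * real k - 16931471"
  define Y' where "Y' = 10000000 * real k - 16931472"
  define Z' where "Z' = 10000000 * real k - 26931472"
  have XYZ: "real_of_int X = X'" "real_of_int Y = Y'" "real_of_int Z = Z'"
    by (simp_all add: X_def Y_def Z_def X'_def Y'_def Z'_def)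
  have k': "real k \<ge> 10" using k by simp
  have pos: "X' > 0" "Y' > 10000000" "Z' > 0" "y > 0" "z > 0"
    using k' rho_le_1 unfolding X'_def Y'_def Z'_def y_def z_def by linarith+
  have yz: "10000000 * y \<le> X'" "Y' \<le> 10000000 * y" "Z' \<le> 10000000 * z"
    using rho_bounds by (simp_all add: X'_def Y'_def Z'_def y_def z_def)
  have G0: "model 0 k > 0" using k by (intro model_pos) simp
  have a1: "2402265 / X' \<le> \<rho>\<^sup>2 / (2 * y)"
  proof -
    have "2402265 / X' \<le> 2402265 / (10000000 * y)"
      using yz pos by (intro divide_left_mono) auto
    also have "\<dots> = (4804530 / 10000000) / (2 * y)" using pos by simp
    also have "\<dots> \<le> \<rho>\<^sup>2 / (2 * y)"
      using rho_square_bounds pos by (intro divide_right_mono) auto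
    finally show ?thesis .
  qed
  have a2: "\<rho>\<^sup>2 / (2 * y) \<le> 2402267 / Y'"
  proof -
    have "\<rho>\<^sup>2 / (2 * y) \<le> (4804534 / 10000000) / (2 * y)"
      using rho_square_bounds pos by (intro divide_right_mono) auto
    also have "\<dots> = 2402267 / (10000000 * y)" using pos by simp
    also have "\<dots> \<le> 2402267 / Y'"
      using yz pos by (intro divide_left_mono) auto
    finally show ?thesis .
  qed
  have a3: "7 / 24 * \<rho>\<^sup>2 / (y * z) \<le> 14013216000000 / (Y' * Z')"
  proof -
    have "7 / 24 * \<rho>\<^sup>2 / (y * z) \<le> (14013216 / 100000000) / (y * z)"
      using rho_square_bounds pos by (intro divide_right_mono) auto
    also have "\<dots> = 14013216000000 / ((10000000 * y) * (10000000 * z))" using pos by simp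
    also have "\<dots> \<le> 14013216000000 / (Y' * Z')"
      using yz pos by (intro divide_left_mono mult_mono mult_pos_pos) auto
    finally show ?thesis .
  qed
  { assume "647803 * (U * (X * Y * Z - 2402265 * Y * Z + 14013216000000 * X) + X * Y * Z) \<le> 1000000 * x * (X * Y * Z)"
    then have "real_of_int (647803 * (U * (X * Y * Z - 2402265 * Y * Z + 14013216000000 * X) + X * Y * Z))
        \<le> real_of_int (1000000 * x * (X * Y * Z))" by (simp only: of_int_le_iff)
    then have c: "647803 * (U * (X' * Y' * Z' - 2402265 * Y' * Z' + 14013216000000 * X') + X' * Y' * Z')
        \<le> 1000000 * x * (X' * Y' * Z')"
      by (simp add: XYZ)
    define Q where "Q = 1 - 2402265 / X' + 14013216000000 / (Y' * Z')"
    have Q: "X' * Y' * Z' - 2402265 * Y' * Z' + 14013216000000 * X' = Q * (X' * Y' * Z')"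
      using pos by (simp add: Q_def field_simps)
    have P: "X' * Y' * Z' > 0" using pos by simp
    have "(647803 * (U * Q + 1)) * (X' * Y' * Z') \<le> (1000000 * x) * (X' * Y' * Z')"
      using c unfolding Q by (simp add: algebra_simps)
    then have 1: "647803 * (U * Q + 1) \<le> 1000000 * x"
      using P by (simp only: mult_le_cancel_right_pos)
    have "0 \<le> 2402265 / X'" "2402265 / X' \<le> 1" using pos k' by (simp_all add: X'_def)
    then have "Q \<ge> 0" using pos by (simp add: Q_def)
    have "lower_model k = model 0 k * (1 - \<rho>\<^sup>2 / (2 * y) + 7 / 24 * \<rho>\<^sup>2 / (y * z)) + 1"
      using lower_model_eq[of k] k by (simp add: y_def z_def)
    also have "\<dots> \<le> model 0 k * Q + 1"
      using a1 a3 G0 by (intro add_right_mono mult_left_mono) (auto simp: Q_def)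
    also have "\<dots> \<le> U * Q + 1"
      using model \<open>Q \<ge> 0\<close> by (intro add_right_mono mult_right_mono) auto
    finally show "647803 / 1000000 * lower_model k \<le> real_of_int x" using 1 by simp }
  { assume "10000 * x * Y \<le> 6479 * (L * (Y - 2402267) - Y)"
    then have "real_of_int (10000 * x * Y) \<le> real_of_int (6479 * (L * (Y - 2402267) - Y))"
      by (simp only: of_int_le_iff)
    then have c: "10000 * x * Y' \<le> 6479 * (L * (Y' - 2402267) - Y')"
      by (simp add: XYZ)
    define Q where "Q = 1 - 2402267 / Y'"
    have Q: "Y' - 2402267 = Q * Y'"
      using pos by (simp add: Q_def field_simps)
    have "(10000 * x) * Y' \<le> (6479 * (L * Q - 1)) * Y'"
      using c unfolding Q by (simp add: algebra_simps)
    then have 1: "10000 * x \<le> 6479 * (L * Q - 1)"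
      using pos by (simp only: mult_le_cancel_right_pos)
    have "Q \<ge> 0" using pos by (simp add: Q_def)
    have "L * Q - 1 \<le> model 0 k * Q - 1"
      using model \<open>Q \<ge> 0\<close> by (intro diff_right_mono mult_right_mono) auto
    also have "\<dots> \<le> model 0 k * (1 - \<rho>\<^sup>2 / (2 * y)) - 1"
      using a2 G0 by (intro diff_right_mono mult_left_mono) (auto simp: Q_def)
    also have "\<dots> = upper_model k"
      using upper_model_eq[of k] k by (simp add: y_def)
    finally show "real_of_int x \<le> 6479 / 10000 * upper_model k" using 1 by simp }
qed

lemma window_check_sound:
  assumes "window_check (int k) U L (map (\<lambda>i. int (tree_count i)) (rev [m..<Suc k]))"
    and "real_of_int L \<le> model 0 k" "model 0 k \<le> real_of_int U" "10 \<le> m" "m \<le> i" "i \<le> k"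
  shows "647803 / 1000000 * lower_model i \<le> real (tree_count i) \<and> real (tree_count i) \<le> 6479 / 10000 * upper_model i"
  using assms
proof (induction k arbitrary: U L)
  case (Suc k)
  have "rev [m..<Suc (Suc k)] = Suc k # rev [m..<Suc k]"
    using Suc.prems by simp
  with Suc.prems(1) have chk: "window_check (int (Suc k)) U L
      (int (tree_count (Suc k)) # map (\<lambda>i. int (tree_count i)) (rev [m..<Suc k]))" by simp
  show ?case
  proof (cases "i = Suc k")
    case True
    have "Suc k \<ge> 10" using Suc.prems by linarith
    from window_check_single[OF this Suc.prems(2,3), of "int (tree_count (Suc k))"] chk True
    show ?thesis by (simp add: Let_def)
  next
    case False
    have k: "k \<ge> 1" "i \<le> k" using Suc.prems False by linarith+
    have "int (Suc k) - 1 = int k" by simp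
    with chk have "window_check (int k) (step_hi (int k) U) (step_lo (int k) L)
        (map (\<lambda>i. int (tree_count i)) (rev [m..<Suc k]))"
      by (simp only: window_check.simps Let_def)
    then show ?thesis
      using Suc.prems k step_hi[OF k(1)] step_lo[OF k(1)] by (intro Suc.IH) auto
  qed
qed simp

text \<open>
  Reduction of \<open>x powr \<rho>\<close> to logarithms of numbers near 1, where \<open>ln_approx_bounds\<close> converges fast; the
  powers of 2 taken out fit \<open>x \<approx> 79\<close> and \<open>w \<approx> 20.7\<close>.
\<close>

lemma powr_rho_ge:
  fixes x w A B :: real
  assumes "ln (x / 64) \<ge> A" "ln (w / 16) \<le> B" "x > 0" "w > 0"
    and "4 * (6931471806 / 10000000000) + B
           \<le> (6931471805 / 10000000000) * (6 * (6931471805 / 10000000000) + A)" "A \<ge> 0"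
  shows "w \<le> x powr \<rho>"
proof -
  have x: "ln x = 6 * \<rho> + ln (x / 64)"
    using assms ln_realpow[of 2 6] by (simp add: ln_div \<rho>_def)
  have w: "ln w = 4 * \<rho> + ln (w / 16)"
    using assms ln_realpow[of 2 4] by (simp add: ln_div \<rho>_def)
  have "ln w \<le> 4 * (6931471806 / 10000000000) + B"
    unfolding w using assms rho_bounds(2) by (intro add_mono mult_left_mono) auto
  also have "\<dots> \<le> (6931471805 / 10000000000) * (6 * (6931471805 / 10000000000) + A)"
    by (rule assms)
  also have "\<dots> \<le> \<rho> * ln x"
    unfolding x using assms rho_bounds(1) by (intro mult_mono add_mono mult_left_mono) auto
  finally have "exp (ln w) \<le> exp (\<rho> * ln x)" by simp
  then show ?thesis using assms by (simp add: powr_def)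
qed

lemma powr_rho_le:
  fixes x w A B :: real
  assumes "ln (x / 64) \<le> A" "ln (w / 16) \<ge> B" "x > 0" "w > 0" "ln (x / 64) \<ge> 0"
    and "(6931471806 / 10000000000) * (6 * (6931471806 / 10000000000) + A)
           \<le> 4 * (6931471805 / 10000000000) + B"
  shows "x powr \<rho> \<le> w"
proof -
  have x: "ln x = 6 * \<rho> + ln (x / 64)"
    using assms ln_realpow[of 2 6] by (simp add: ln_div \<rho>_def)
  have w: "ln w = 4 * \<rho> + ln (w / 16)"
    using assms ln_realpow[of 2 4] by (simp add: ln_div \<rho>_def)
  have "\<rho> * ln x \<le> (6931471806 / 10000000000) * (6 * (6931471806 / 10000000000) + A)"
    unfolding x using assms rho_bounds(2) by (intro mult_mono add_mono mult_left_mono) auto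
  also have "\<dots> \<le> 4 * (6931471805 / 10000000000) + B"
    by (rule assms)
  also have "\<dots> \<le> ln w"
    unfolding w using assms rho_bounds(1) by (intro add_mono mult_left_mono) auto
  finally have "exp (\<rho> * ln x) \<le> exp (ln w)" by simp
  then show ?thesis using assms by (simp add: powr_def)
qed

text \<open>
  Repeated squaring with outward rounding keeps the numerals short.
\<close>

lemma rho_power_80:
  "18451721058710 / 10 ^ 26 \<le> \<rho> ^ 80" "\<rho> ^ 80 \<le> 18451721272201 / 10 ^ 26"
proof -
  have square: "c \<le> \<rho> ^ (2 * e) \<and> \<rho> ^ (2 * e) \<le> d"
    if "l \<le> \<rho> ^ e \<and> \<rho> ^ e \<le> h" "0 \<le> l" "c \<le> l * l" "h * h \<le> d" for c d l h :: real and e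
  proof -
    have "l * l \<le> \<rho> ^ e * \<rho> ^ e" "\<rho> ^ e * \<rho> ^ e \<le> h * h"
      using that by (auto intro!: mult_mono)
    then show ?thesis using that by (simp add: mult_2 power_add)
  qed
  have "6931471805 / 10 ^ 10 \<le> \<rho> ^ 1 \<and> \<rho> ^ 1 \<le> 6931471806 / 10 ^ 10"
    using rho_bounds by simp
  from square[OF this, of "4804530138350 / 10 ^ 13" "4804530139738 / 10 ^ 13"]
  have "4804530138350 / 10 ^ 13 \<le> \<rho> ^ 2 \<and> \<rho> ^ 2 \<le> 4804530139738 / 10 ^ 13" by simp
  from square[OF this, of "2308350985031 / 10 ^ 13" "2308350986366 / 10 ^ 13"]
  have "2308350985031 / 10 ^ 13 \<le> \<rho> ^ 4 \<and> \<rho> ^ 4 \<le> 2308350986366 / 10 ^ 13" by simp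
  from square[OF this, of "5328484270093 / 10 ^ 14" "5328484276257 / 10 ^ 14"]
  have "5328484270093 / 10 ^ 14 \<le> \<rho> ^ 8 \<and> \<rho> ^ 8 \<le> 5328484276257 / 10 ^ 14" by simp
  from square[OF this, of "2839274461662 / 10 ^ 15" "2839274468232 / 10 ^ 15"]
  have p16: "2839274461662 / 10 ^ 15 \<le> \<rho> ^ 16 \<and> \<rho> ^ 16 \<le> 2839274468232 / 10 ^ 15" by simp
  from square[OF this, of "8061479468646 / 10 ^ 18" "8061479505955 / 10 ^ 18"]
  have "8061479468646 / 10 ^ 18 \<le> \<rho> ^ 32 \<and> \<rho> ^ 32 \<le> 8061479505955 / 10 ^ 18" by simp
  from square[OF this, of "6498745122340 / 10 ^ 23" "6498745182494 / 10 ^ 23"]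
  have p64: "6498745122340 / 10 ^ 23 \<le> \<rho> ^ 64 \<and> \<rho> ^ 64 \<le> 6498745182494 / 10 ^ 23" by simp
  have split: "\<rho> ^ 80 = \<rho> ^ 64 * \<rho> ^ 16" by (simp add: power_add[symmetric])
  have "18451721058710 / 10 ^ 26 \<le> (6498745122340 / 10 ^ 23) * (2839274461662 / 10 ^ 15 :: real)" by simp
  also have "\<dots> \<le> \<rho> ^ 80"
    unfolding split using p16 p64 by (intro mult_mono) auto
  finally show "18451721058710 / 10 ^ 26 \<le> \<rho> ^ 80" .
  have "\<rho> ^ 80 \<le> (6498745182494 / 10 ^ 23) * (2839274468232 / 10 ^ 15)"
    unfolding split using p16 p64 by (intro mult_mono) auto
  also have "\<dots> \<le> 18451721272201 / 10 ^ 26" by simp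
  finally show "\<rho> ^ 80 \<le> 18451721272201 / 10 ^ 26" .
qed

text \<open>
  A rounded upper bound of \<open>model 0 80\<close>; it exceeds the lower bound \<open>model_80_lo\<close> by a relative amount of
  about \<open>1.4 / 10 ^ 5\<close>.
\<close>

definition model_80_hi :: int where "model_80_hi = 23425130976 * 10 ^ 118"

definition model_80_lo :: int where "model_80_lo = 23424800907 * 10 ^ 118"

text \<open>
  The shift \<open>0.8466\<close> is just above \<open>(1 + \<rho>) / 2 \<approx> 0.84657\<close>, as \<open>Gamma_upper\<close> demands, and
  \<open>20.6975446\<close> is just below \<open>(80 - 0.8466) powr \<rho>\<close>.
\<close>

lemma model_80_upper: "model 0 80 \<le> real_of_int model_80_hi"
proof -
  have A: "212504657 / 1000000000 \<le> ln (791534 / 10000 / 64 :: real)"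
    using ln_approx_bounds[of "791534 / 10000 / 64" 4] by (simp add: eval_nat_numeral)
  have B: "ln (206975446 / 10000000 / 16 :: real) \<le> 257426357 / 1000000000"
    using ln_approx_bounds[of "206975446 / 10000000 / 16" 4] by (simp add: eval_nat_numeral)
  have w: "206975446 / 10000000 \<le> (791534 / 10000) powr \<rho>"
    by (rule powr_rho_ge[OF A B]) simp_all
  have "Gamma (real 80 - \<rho>) \<le> fact (80 - 1) / (real 80 - 8466 / 10000) powr \<rho>"
    using rho_bounds by (intro Gamma_upper) auto
  also have "real 80 - 8466 / 10000 = 791534 / 10000" by simp
  also have "fact (80 - 1) / (791534 / 10000) powr \<rho> \<le> fact (80 - 1) / (206975446 / 10000000)"
    using w by (intro divide_left_mono mult_pos_pos) auto
  finally have g: "Gamma (real 80 - \<rho>) \<le> fact (80 - 1) / (206975446 / 10000000)" .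
  have "model 0 80 = Gamma (real 80 - \<rho>) / \<rho> ^ 80"
    by (simp add: model_def)
  also have "\<dots> \<le> fact (80 - 1) / (206975446 / 10000000) / (18451721058710 / 10 ^ 26)"
    using g rho_power_80(1) by (intro frac_le) auto
  also have "\<dots> \<le> real_of_int model_80_hi"
    by (simp add: fact_numeral model_80_hi_def)
  finally show ?thesis .
qed

text \<open>
  The shift \<open>0.845\<close> is so far below \<open>(1 + \<rho>) / 2\<close> that the monotonicity condition of \<open>Gamma_lower\<close> holds
  at 80, and \<open>20.697836\<close> is just above \<open>(80 - 0.845) powr \<rho>\<close>.
\<close>

lemma model_80_lower: "real_of_int model_80_lo \<le> model 0 80"
proof -
  have A: "ln (79155 / 1000 / 64 :: real) \<le> 212524875 / 1000000000"
    using ln_approx_bounds[of "79155 / 1000 / 64" 4] by (simp add: eval_nat_numeral)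
  have B: "257440428 / 1000000000 \<le> ln (20697836 / 1000000 / 16 :: real)"
    using ln_approx_bounds[of "20697836 / 1000000 / 16" 4] by (simp add: eval_nat_numeral)
  have w: "(79155 / 1000) powr \<rho> \<le> 20697836 / 1000000"
    by (rule powr_rho_le[OF A B]) simp_all
  have "real_of_int model_80_lo \<le> fact (80 - 1) / (20697836 / 1000000) / (18451721272201 / 10 ^ 26 :: real)"
    by (simp add: fact_numeral model_80_lo_def)
  also have "\<dots> \<le> Gamma (real 80 - \<rho>) / \<rho> ^ 80"
  proof (rule frac_le)
    have "fact (80 - 1) / (20697836 / 1000000) \<le> fact (80 - 1) / (79155 / 1000) powr \<rho>"
      using w by (intro divide_left_mono mult_pos_pos) auto
    also have "(79155 / 1000 :: real) = real 80 - 845 / 1000" by simp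
    also have "fact (80 - 1) / (real 80 - 845 / 1000) powr \<rho> \<le> Gamma (real 80 - \<rho>)"
      using rho_bounds by (intro Gamma_lower) auto
    finally show "fact (80 - 1) / (20697836 / 1000000) \<le> Gamma (real 80 - \<rho>)" .
    show "\<rho> ^ 80 \<le> 18451721272201 / 10 ^ 26"
      by (rule rho_power_80(2))
  qed (use rho_le_1 in \<open>auto intro!: less_imp_le[OF Gamma_real_pos]\<close>)
  also have "\<dots> = model 0 80"
    by (simp add: model_def)
  finally show ?thesis .
qed

text \<open>
  The tree counts for the sizes 79 down to 40 are the first 40 entries of the table.
\<close>

lemma window_check_holds: "window_check 79
  (step_hi 79 model_80_hi) (step_lo 79 model_80_lo)
  (take 40 (count_table 78 [1, 1] [1] [1, 0]))"
  by code_simp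

lemma take_count_table:
  "take m (count_table j [1, 1] [1] [1, 0]) = map (\<lambda>i. int (tree_count i)) (rev [2 + j - m..<2 + j])"
proof -
  have "take m (rev [0..<n]) = rev [n - m..<n]" for n
    by (simp add: take_rev)
  then show ?thesis
    by (simp only: count_table_eq take_map)
qed

lemma window_bounds:
  assumes "40 \<le> k" "k < 80"
  shows "647803 / 1000000 * lower_model k \<le> real (tree_count k) \<and> real (tree_count k) \<le> 6479 / 10000 * upper_model k"
proof (rule window_check_sound[where m = 40 and k = 79])
  have "2 + 78 - 40 = (40::nat)" "2 + 78 = Suc 79" "int 79 = 79"
    by simp_all
  then show "window_check (int 79) (step_hi (int 79) model_80_hi) (step_lo (int 79) model_80_lo)
      (map (\<lambda>i. int (tree_count i)) (rev [40..<Suc 79]))"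
    using window_check_holds unfolding take_count_table by (simp only:)
  show "model 0 79 \<le> real_of_int (step_hi (int 79) model_80_hi)"
    using step_hi[of 79 model_80_hi] model_80_upper by simp
  show "real_of_int (step_lo (int 79) model_80_lo) \<le> model 0 79"
    using step_lo[of 79 model_80_lo] model_80_lower by simp
qed (use assms in auto)

theorem theorem3:
  shows "\<exists>\<eta>::real. \<bar>\<eta> - 0.647852\<bar> < 5 / 10 ^ 5 \<and>
    (\<lambda>n. real (B n)) \<sim>[at_top]
      (\<lambda>n. \<eta> * real n powr (- ln 2) * (1 / ln 2) ^ n * fact (n - 1))"
proof -
  obtain \<eta> where \<eta>: "647803 / 1000000 \<le> \<eta>" "\<eta> \<le> 6479 / 10000"
      and lim: "(\<lambda>n. real (tree_count n) / model 0 n) \<longlonglongrightarrow> \<eta>"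
    using tree_count_over_model_limit[of "647803 / 1000000" "6479 / 10000"] window_bounds by auto
  have "(\<lambda>n. real (tree_count n) / model 0 n * (Gamma (real n - \<rho>) / (real n powr (- \<rho>) * fact (n - 1))) / \<eta>)
      \<longlonglongrightarrow> \<eta> * 1 / \<eta>"
    using \<eta> by (intro tendsto_intros lim Gamma_ratio_tendsto) simp
  moreover have "\<forall>\<^sub>F n in sequentially.
      real (tree_count n) / model 0 n * (Gamma (real n - \<rho>) / (real n powr (- \<rho>) * fact (n - 1))) / \<eta>
      = real (B n) / (\<eta> * real n powr (- ln 2) * (1 / ln 2) ^ n * fact (n - 1))"
    using eventually_ge_at_top[of 2]
  proof eventually_elim
    case (elim n)
    define \<gamma> where "\<gamma> = Gamma (real n - \<rho>)"
    have "\<gamma> > 0" unfolding \<gamma>_def using elim rho_le_1 by (intro Gamma_real_pos) simp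
    then show ?case using elim
      unfolding model_def by (simp add: B_eq_tree_count \<gamma>_def[symmetric] \<rho>_def[symmetric] power_divide field_simps)
  qed
  ultimately have "(\<lambda>n. real (B n) / (\<eta> * real n powr (- ln 2) * (1 / ln 2) ^ n * fact (n - 1)))
      \<longlonglongrightarrow> \<eta> * 1 / \<eta>"
    by (rule Lim_transform_eventually)
  then have "(\<lambda>n. real (B n)) \<sim>[at_top]
      (\<lambda>n. \<eta> * real n powr (- ln 2) * (1 / ln 2) ^ n * fact (n - 1))"
    using \<eta> by (intro asymp_equivI') simp
  moreover have "\<bar>\<eta> - 0.647852\<bar> < 5 / 10 ^ 5"
    unfolding abs_less_iff using \<eta> by simp
  ultimately show ?thesis by blast
qed

end
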